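(* Let $n\ge0$ be an integer. Then: (1) There is a $\widehat{\mathbb Z}$-linear combination $G_n$ of the power series $A_{a_1},A_{a_2},\dots,A_{a_{n+1}}$ for some $a_1,a_2,\dots,a_{n+1}\in\widehat{\mathbb Z}^\times$ such that $G_n\equiv d_nx^n$ modulo $x^{n+1}$. (2) The set $S=\bigcap_r\mathrm{Im}(\Phi^r)$ contains a power series $\equiv dx^n\pmod{x^{n+1}}$ if and only if $d$ is divisible by $d_n$ in $\widehat{\mathbb Z}$. The set $S$ consists of all (infinite) $\widehat{\mathbb Z}$-linear combinations of the $G_n$, $n\ge0$.
   Context: $\widehat{\mathbb Z}=\lim\mathbb Z/n\mathbb Z$. $\Phi:\widehat{\mathbb Z}[[x]]\to\widehat{\mathbb Z}[[x]]$ is $\Phi(G)=(x-1)\frac{dG}{dx}$ and the intersection is over all $r\ge1$. For $r\in\widehat{\mathbb Z}$, $A_r(x)=(1-x)^r=\sum_{i\ge0}(-1)^i\binom{r}{i}x^i\in\widehat{\mathbb Z}[[x]]$. For $n\ge0$, $d_n$ is the positive integer whose $p$-adic valuation is, for every prime $p$, $$v_p(d_n)=\left\lfloor\tfrac{n}{p-1}\right\rfloor+v_p\!\left(\left\lfloor\tfrac{n}{p-1}\right\rfloor!\right)-v_p(n!).$$ (E.g. $d_0=1$, $d_1=2$, $d_2=12$, $d_3=8$.) *)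

theory Defs
  imports
    "HOL-Computational_Algebra.Computational_Algebra"
    "HOL-Number_Theory.Cong"
begin

section \<open>The ring of profinite integers\<close>

text \<open>
  The inverse limit of the rings $\mathbf{Z}/n\mathbf{Z}$, $n \ge 1$, ordered by divisibility. An
  element is given by a family \<open>x\<close> of integers, where \<open>x n\<close> represents its component in
  $\mathbf{Z}/n\mathbf{Z}$; two families are identified if all components agree. The index \<open>0\<close>
  is irrelevant.
\<close>

definition compatible :: "(nat \<Rightarrow> int) \<Rightarrow> bool" where
  "compatible x \<longleftrightarrow> (\<forall>m>0. \<forall>n>0. m dvd n \<longrightarrow> [x n = x m] (mod int m))"

definition zhat_rel :: "(nat \<Rightarrow> int) \<Rightarrow> (nat \<Rightarrow> int) \<Rightarrow> bool" where
  "zhat_rel x y \<longleftrightarrow> compatible x \<and> compatible y \<and> (\<forall>n>0. [x n = y n] (mod int n))"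

quotient_type zhat = "nat \<Rightarrow> int" / partial: zhat_rel
proof (rule part_equivpI)
  have "zhat_rel (\<lambda>_. 0) (\<lambda>_. 0)"
    by (simp add: zhat_rel_def compatible_def)
  then show "\<exists>x. zhat_rel x x" by blast
  show "symp zhat_rel"
    by (auto simp: symp_def zhat_rel_def cong_sym_eq)
  show "transp zhat_rel"
    unfolding transp_def zhat_rel_def by (meson cong_trans)
qed

instantiation zhat :: comm_ring_1
begin

lift_definition zero_zhat :: zhat is "\<lambda>_. 0"
  by (simp add: zhat_rel_def compatible_def)

lift_definition one_zhat :: zhat is "\<lambda>_. 1"
  by (simp add: zhat_rel_def compatible_def)

lift_definition plus_zhat :: "zhat \<Rightarrow> zhat \<Rightarrow> zhat" is "\<lambda>x y n. x n + y n"
  by (simp add: zhat_rel_def compatible_def cong_add)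

lift_definition minus_zhat :: "zhat \<Rightarrow> zhat \<Rightarrow> zhat" is "\<lambda>x y n. x n - y n"
  by (simp add: zhat_rel_def compatible_def cong_diff)

lift_definition uminus_zhat :: "zhat \<Rightarrow> zhat" is "\<lambda>x n. - x n"
  by (simp add: zhat_rel_def compatible_def cong_minus_minus_iff)

lift_definition times_zhat :: "zhat \<Rightarrow> zhat \<Rightarrow> zhat" is "\<lambda>x y n. x n * y n"
  by (simp add: zhat_rel_def compatible_def cong_mult)

instance
proof
  show "(0::zhat) \<noteq> 1"
  proof (transfer, rule notI)
    assume "zhat_rel (\<lambda>_. 0) (\<lambda>_. 1)"
    then have "[0 = 1] (mod int 2)" unfolding zhat_rel_def by (metis zero_less_numeral)
    then show False by (simp add: cong_def)
  qed
qed (transfer; simp add: zhat_rel_def compatible_def algebra_simps cong_add cong_diff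
       cong_mult cong_minus_minus_iff)+

end

lemma abs_zhat_eqI: "zhat_rel x y \<Longrightarrow> abs_zhat x = abs_zhat y"
  using Quotient_rel_abs [OF Quotient_zhat] .

lemma abs_zhat_eqD:
  "zhat_rel x x \<Longrightarrow> zhat_rel y y \<Longrightarrow> abs_zhat x = abs_zhat y \<Longrightarrow> zhat_rel x y"
  using Quotient_rel [OF Quotient_zhat] by blast

lemma zhat_repE:
  fixes x :: zhat
  obtains y where "zhat_rel y y" "x = abs_zhat y"
  using Quotient_abs_rep [OF Quotient_zhat] Quotient_rep_reflp [OF Quotient_zhat] by metis

lemma of_nat_zhat: "of_nat k = abs_zhat (\<lambda>_. int k)"
  by (induction k)
     (simp_all add: zero_zhat_def one_zhat_def plus_zhat.abs_eq zhat_rel_def compatible_def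
        add.commute)

lemma zhat_torsion_free:
  fixes x :: zhat
  assumes "k > 0" and "of_nat k * x = 0"
  shows "x = 0"
proof -
  obtain y where "zhat_rel y y" and xy: "x = abs_zhat y" by (rule zhat_repE)
  have rel: "zhat_rel (\<lambda>_. c) (\<lambda>_. c)" for c
    by (simp add: zhat_rel_def compatible_def)
  from \<open>zhat_rel y y\<close> have y: "compatible y" by (simp add: zhat_rel_def)
  have "zhat_rel (\<lambda>n. int k * y n) (\<lambda>_. 0)"
  proof (rule abs_zhat_eqD)
    show "zhat_rel (\<lambda>n. int k * y n) (\<lambda>n. int k * y n)"
      using y by (simp add: zhat_rel_def compatible_def cong_mult)
    show "abs_zhat (\<lambda>n. int k * y n) = abs_zhat (\<lambda>_. 0)"
      using assms(2) \<open>zhat_rel y y\<close> rel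
      by (simp add: xy of_nat_zhat times_zhat.abs_eq zero_zhat_def)
  qed (rule rel)
  then have *: "[int k * y n = 0] (mod int n)" if "n > 0" for n
    using that by (simp add: zhat_rel_def)
  have "[y n = 0] (mod int n)" if "n > 0" for n
  proof -
    have "int k * int n dvd int k * y (k * n)"
      using *[of "k * n"] \<open>k > 0\<close> \<open>n > 0\<close> by (simp add: cong_0_iff)
    then have "[y (k * n) = 0] (mod int n)"
      using \<open>k > 0\<close> by (simp add: cong_0_iff)
    moreover have "[y (k * n) = y n] (mod int n)"
      using y \<open>k > 0\<close> \<open>n > 0\<close> by (simp add: compatible_def)
    ultimately show ?thesis by (metis cong_sym cong_trans)
  qed
  with y show ?thesis
    unfolding xy zero_zhat_def by (intro abs_zhat_eqI) (simp add: zhat_rel_def compatible_def)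
qed


section \<open>Binomial coefficients and the power series $(1-x)^r$\<close>

definition int_choose :: "int \<Rightarrow> nat \<Rightarrow> int" where
  "int_choose a i = (\<Prod>j<i. a - int j) div fact i"

lemma int_choose_mult_fact: "fact i * int_choose a i = (\<Prod>j<i. a - int j)"
proof -
  have "(\<Prod>j<i. a - int j) = pochhammer (a - int i + 1) i"
    by (simp add: falling_fact_pochhammer' lessThan_atLeast0)
  then show ?thesis
    by (simp add: int_choose_def fact_dvd_pochhammer)
qed

lemma int_choose_cong:
  assumes "[a = b] (mod int (n * fact i))"
  shows "[int_choose a i = int_choose b i] (mod int n)"
proof -
  have "[(\<Prod>j<i. a - int j) = (\<Prod>j<i. b - int j)] (mod int (n * fact i))"
    using assms by (intro cong_prod cong_diff) auto
  then have "fact i * int n dvd fact i * (int_choose a i - int_choose b i)"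
    by (simp add: int_choose_mult_fact [symmetric] cong_iff_dvd_diff right_diff_distrib mult.commute)
  then show ?thesis
    by (simp add: cong_iff_dvd_diff)
qed

text \<open>
  The value of $\binom{r}{i}$ modulo \<open>n\<close> depends only on \<open>r\<close> modulo \<open>n * fact i\<close>. The lemma
  after the definition, together with torsion-freeness, says that $\binom{r}{i}$ is the
  quotient of $r(r-1)\cdots(r-i+1)$ by $i!$.
\<close>

lift_definition zhat_choose :: "zhat \<Rightarrow> nat \<Rightarrow> zhat"
  is "\<lambda>r i n. int_choose (r (n * fact i)) i"
proof -
  fix r s :: "nat \<Rightarrow> int" and i :: nat
  assume rs: "zhat_rel r s"
  have comp: "compatible (\<lambda>n. int_choose (r (n * fact i)) i)" if "compatible r" for r
    unfolding compatible_def
  proof (intro allI impI)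
    fix m n :: nat
    assume "m > 0" "n > 0" "m dvd n"
    then have "[r (n * fact i) = r (m * fact i)] (mod int (m * fact i))"
      using that by (simp add: compatible_def del: of_nat_mult)
    then show "[int_choose (r (n * fact i)) i = int_choose (r (m * fact i)) i] (mod int m)"
      by (rule int_choose_cong)
  qed
  have "[int_choose (r (n * fact i)) i = int_choose (s (n * fact i)) i] (mod int n)"
    if "n > 0" for n
    using rs that by (intro int_choose_cong) (simp add: zhat_rel_def del: of_nat_mult)
  with rs comp show
    "zhat_rel (\<lambda>n. int_choose (r (n * fact i)) i) (\<lambda>n. int_choose (s (n * fact i)) i)"
    by (simp add: zhat_rel_def)
qed

lemma zhat_choose_mult_fact: "of_nat (fact i) * zhat_choose r i = (\<Prod>j<i. r - of_nat j)"
proof -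
  obtain s where rr: "zhat_rel s s" and rs: "r = abs_zhat s" by (rule zhat_repE)
  from rr have r: "compatible s" by (simp add: zhat_rel_def)
  have rel: "zhat_rel (\<lambda>_. c) (\<lambda>_. c)" for c
    by (simp add: zhat_rel_def compatible_def)
  have prod: "zhat_rel (\<lambda>n. \<Prod>j<i. s n - int j) (\<lambda>n. \<Prod>j<i. s n - int j) \<and>
      (\<Prod>j<i. abs_zhat s - of_nat j) = abs_zhat (\<lambda>n. \<Prod>j<i. s n - int j)" for i
  proof (induction i)
    case 0
    show ?case by (simp add: rel one_zhat_def)
  next
    case (Suc i)
    have "zhat_rel (\<lambda>n. s n - int i) (\<lambda>n. s n - int i)"
      using r by (simp add: zhat_rel_def compatible_def cong_diff)
    with Suc rr rel show ?case
      by (simp add: of_nat_zhat minus_zhat.abs_eq times_zhat.abs_eq zhat_rel_def compatible_def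
            cong_mult)
  qed
  have chs: "zhat_rel (\<lambda>n. int_choose (s (n * fact i)) i) (\<lambda>n. int_choose (s (n * fact i)) i)"
    using zhat_choose.rsp rr by (auto simp: rel_fun_def)
  have "of_nat (fact i) * zhat_choose (abs_zhat s) i =
      abs_zhat (\<lambda>n. fact i * int_choose (s (n * fact i)) i)"
    unfolding of_nat_zhat of_nat_fact using rr rel chs
    by (simp add: zhat_choose.abs_eq times_zhat.abs_eq)
  also have "\<dots> = abs_zhat (\<lambda>n. \<Prod>j<i. s (n * fact i) - int j)"
    by (simp add: int_choose_mult_fact)
  also have "\<dots> = abs_zhat (\<lambda>n. \<Prod>j<i. s n - int j)"
  proof -
    have *: "[(\<Prod>j<i. s (n * fact i) - int j) = (\<Prod>j<i. s n - int j)] (mod int n)"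
      if "n > 0" for n
      using r that by (intro cong_prod cong_diff) (auto simp: compatible_def)
    have "zhat_rel (\<lambda>n. \<Prod>j<i. s n - int j) (\<lambda>n. \<Prod>j<i. s n - int j)"
      using prod by blast
    then have "compatible (\<lambda>n. \<Prod>j<i. s n - int j)" by (simp add: zhat_rel_def)
    moreover have "compatible (\<lambda>n. \<Prod>j<i. s (n * fact i) - int j)"
      unfolding compatible_def
    proof (intro allI impI)
      fix m n :: nat assume mn: "m > 0" "n > 0" "m dvd n"
      have "[s (n * fact i) = s (m * fact i)] (mod int (m * fact i))"
        using r mn by (simp add: compatible_def del: of_nat_mult)
      then have "[s (n * fact i) = s (m * fact i)] (mod int m)"
        by (rule cong_dvd_modulus) simp
      then show "[(\<Prod>j<i. s (n * fact i) - int j) = (\<Prod>j<i. s (m * fact i) - int j)] (mod int m)"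
        by (intro cong_prod cong_diff) auto
    qed
    ultimately show ?thesis
      using * by (intro abs_zhat_eqI) (auto simp: zhat_rel_def)
  qed
  finally show ?thesis using prod by (simp add: rs)
qed

definition A_series :: "zhat \<Rightarrow> zhat fps" where
  "A_series r = Abs_fps (\<lambda>i. (-1) ^ i * zhat_choose r i)"


section \<open>The operator $\Phi$\<close>

definition Phi :: "zhat fps \<Rightarrow> zhat fps" where
  "Phi G = (fps_X - 1) * fps_deriv G"

definition S_set :: "zhat fps set" where
  "S_set = (\<Inter>r\<in>{1..}. range (Phi ^^ r))"


section \<open>The integers $d_n$\<close>

definition d_val :: "nat \<Rightarrow> nat \<Rightarrow> int" where
  "d_val n p = int (n div (p - 1)) + int (multiplicity p (fact (n div (p - 1)) :: nat))
                 - int (multiplicity p (fact n :: nat))"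

definition d_seq :: "nat \<Rightarrow> nat" where
  "d_seq n = (THE d. d > 0 \<and> (\<forall>p. prime p \<longrightarrow> int (multiplicity p d) = d_val n p))"

lemma multiplicity_fact_rec:
  fixes p :: nat
  assumes "prime p"
  shows "multiplicity p (fact n :: nat) = n div p + multiplicity p (fact (n div p) :: nat)"
proof (induction n)
  case 0
  show ?case by simp
next
  case (Suc n)
  have p: "prime_elem p" "p > 1" using assms prime_gt_1_nat by auto
  have step: "multiplicity p (fact (Suc m) :: nat) = multiplicity p (Suc m) + multiplicity p (fact m :: nat)" for m
    using p by (simp add: prime_elem_multiplicity_mult_distrib del: mult_Suc)
  show ?case
  proof (cases "p dvd Suc n")
    case False
    then have "Suc n div p = n div p"
      by (simp add: div_Suc dvd_eq_mod_eq_0)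
    then show ?thesis
      using Suc step[of n] False by (simp add: not_dvd_imp_multiplicity_0 del: fact_Suc)
  next
    case True
    then obtain k where "Suc n = p * k" by blast
    moreover from this obtain l where l: "k = Suc l" by (cases k) auto
    ultimately have k: "Suc n = p * Suc l" by simp
    have "Suc n div p = Suc l"
      unfolding k using p by simp
    moreover from this have "n div p = l"
      using True by (simp add: div_Suc dvd_eq_mod_eq_0)
    moreover have "multiplicity p (Suc n) = Suc (multiplicity p (Suc l))"
      unfolding k using p by (intro multiplicity_times_same) auto
    ultimately show ?thesis
      using Suc step[of n] step[of l] by (simp del: fact_Suc)
  qed
qed

lemma multiplicity_fact_le:
  fixes p :: nat
  assumes "prime p"
  shows "(p - 1) * multiplicity p (fact n :: nat) \<le> n"
proof (induction n rule: less_induct)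
  case (less n)
  show ?case
  proof (cases "n = 0")
    case False
    have p: "p > 1" using assms prime_gt_1_nat by blast
    have "(p - 1) * multiplicity p (fact n :: nat)
        = (p - 1) * (n div p) + (p - 1) * multiplicity p (fact (n div p) :: nat)"
      by (subst multiplicity_fact_rec [OF assms]) (rule distrib_left)
    also have "\<dots> \<le> (p - 1) * (n div p) + n div p"
      using less[of "n div p"] p False by simp
    also have "\<dots> = p * (n div p)"
      using p by (cases p) simp_all
    also have "\<dots> \<le> n" by simp
    finally show ?thesis .
  qed simp
qed

lemma d_val_nonneg:
  assumes "prime p"
  shows "d_val n p \<ge> 0"
proof -
  have "p - 1 > 0" using assms prime_gt_1_nat by simp
  then have "multiplicity p (fact n :: nat) \<le> n div (p - 1)"
    using multiplicity_fact_le [OF assms, of n] by (simp add: less_eq_div_iff_mult_less_eq mult.commute)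
  then show ?thesis by (simp add: d_val_def)
qed

lemma d_val_eq_0:
  assumes "prime p" "p > n + 1"
  shows "d_val n p = 0"
proof -
  have "(p - 1) * multiplicity p (fact n :: nat) < p - 1"
    using multiplicity_fact_le [OF assms(1), of n] assms(2) by linarith
  then have "multiplicity p (fact n :: nat) = 0"
    by (metis mult.right_neutral mult_le_mono2 less_one not_le)
  with assms(2) show ?thesis by (simp add: d_val_def)
qed

lemma d_seq_ex1:
  "\<exists>!d. d > 0 \<and> (\<forall>p. prime p \<longrightarrow> int (multiplicity p d) = d_val n p)"
proof (rule ex_ex1I)
  define P where "P = {p. prime p \<and> p \<le> n + 1}"
  define d where "d = (\<Prod>p\<in>P. p ^ nat (d_val n p))"
  have P: "finite P" "\<And>p. p \<in> P \<Longrightarrow> prime p" by (auto simp: P_def)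
  have "d > 0"
    unfolding d_def using P by (intro prod_pos) (auto simp: prime_gt_0_nat)
  moreover have "int (multiplicity p d) = d_val n p" if "prime p" for p
    unfolding d_def using multiplicity_prod_prime_powers [OF P(1) P(2) that, of "\<lambda>p. nat (d_val n p)"]
      d_val_nonneg [OF that, of n] d_val_eq_0 [OF that, of n]
    by (auto simp: P_def that)
  ultimately show "\<exists>d. d > 0 \<and> (\<forall>p. prime p \<longrightarrow> int (multiplicity p d) = d_val n p)" by blast
next
  fix d e :: nat
  assume d: "d > 0 \<and> (\<forall>p. prime p \<longrightarrow> int (multiplicity p d) = d_val n p)"
    and e: "e > 0 \<and> (\<forall>p. prime p \<longrightarrow> int (multiplicity p e) = d_val n p)"
  show "d = e"
  proof (rule multiplicity_eq_nat)
    fix p :: nat assume "prime p"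
    with d e have "int (multiplicity p d) = int (multiplicity p e)" by simp
    then show "multiplicity p d = multiplicity p e" by simp
  qed (use d e in auto)
qed

lemma d_seq_pos: "d_seq n > 0"
  and multiplicity_d_seq: "prime p \<Longrightarrow> int (multiplicity p (d_seq n)) = d_val n p"
  using theI' [OF d_seq_ex1 [of n]] unfolding d_seq_def by blast+


section \<open>The series $G_n$\<close>

text \<open>$F \equiv c x^n \pmod{x^{n+1}}$; here \<open>c\<close> may be zero.\<close>

definition cong_monom :: "zhat fps \<Rightarrow> zhat \<Rightarrow> nat \<Rightarrow> bool" where
  "cong_monom F c n \<longleftrightarrow> fps_X ^ (n + 1) dvd F - fps_const c * fps_X ^ n"

definition is_G :: "nat \<Rightarrow> zhat fps \<Rightarrow> bool" where
  "is_G n G \<longleftrightarrow>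
     (\<exists>a c. (\<forall>i\<in>{1..n+1}. a i dvd 1) \<and>
        G = (\<Sum>i=1..n+1. fps_const (c i) * A_series (a i))) \<and>
     cong_monom G (of_nat (d_seq n)) n"

text \<open>
  Infinite linear combinations $\sum_n c_n G_n$ are sums in the \<open>x\<close>-adic topology, which is the
  library's topology on \<^typ>\<open>zhat fps\<close>. They all converge, since $G_n$ is divisible by $x^n$.
\<close>

lemma summable_G:
  assumes "\<And>k. is_G k (G k)"
  shows "summable (\<lambda>k. fps_const (c k) * G k)"
proof -
  have zero: "G k $ i = 0" if ik: "i < k" for i k
  proof -
    from assms[of k] obtain H
      where "G k - fps_const (of_nat (d_seq k)) * fps_X ^ k = fps_X ^ (k + 1) * H"
      unfolding is_G_def cong_monom_def by (elim conjE dvdE)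
    then have "G k = fps_const (of_nat (d_seq k)) * fps_X ^ k + fps_X ^ (k + 1) * H"
      by (simp add: algebra_simps)
    then show ?thesis
      using ik by (simp only: fps_add_nth fps_X_power_mult_nth fps_X_power_mult_right_nth) simp
  qed
  have "(\<lambda>k. fps_const (c k) * G k) sums Abs_fps (\<lambda>i. \<Sum>k\<le>i. c k * G k $ i)"
    unfolding sums_def
  proof (rule tendsto_fpsI)
    fix i
    have "(\<Sum>k<m. fps_const (c k) * G k) $ i = (\<Sum>k\<le>i. c k * G k $ i)" if "m > i" for m
      unfolding fps_sum_nth using that zero
      by (subst sum.mono_neutral_right [of "{..<m}" "{..i}"]) auto
    then show "\<forall>\<^sub>F m in sequentially.
        (\<Sum>k<m. fps_const (c k) * G k) $ i = Abs_fps (\<lambda>i. \<Sum>k\<le>i. c k * G k $ i) $ i"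
      unfolding eventually_sequentially by (intro exI[of _ "Suc i"]) simp
  qed
  then show ?thesis by (rule sums_summable)
qed

end

theory Submission
  imports Defs "HOL-Number_Theory.Residues"
begin

text \<open>
  The series $A_a$ is an eigenvector of $\Phi$ with eigenvalue $a$, so it lies in $S$ if $a$ is a
  unit. Put $e = n!\,d_n$; then $v_p(e) = q + v_p(q!)$ with $q = \lfloor n/(p-1) \rfloor$, so $e$ is
  Bhargava's generalized factorial of $\widehat{\mathbf{Z}}^\times$.

  Existence of $G_n$: choose units $a_0, \dots, a_n$ which in every $\mathbf{Z}_p$ look like the first
  $n + 1$ positive integers prime to $p$. Then $c_j = e / \prod_{i \ne j} (a_j - a_i)$ is integral, and
  Lagrange interpolation shows that $\pm\sum_j c_j A_{a_j} \equiv d_n x^n$.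

  Divisibility: if $F = \Phi^k H$ with leading term $d x^n$, then $\prod_{j<n} (\Phi - b_j)$ maps $F$ to a
  series with constant term $\pm n!\,d$. For suitable integers $b_j$ and large $k$, all integer values of
  the polynomial $r^k \prod_{j<n} (r - b_j)$ are divisible by $e$, and so is the constant term of
  $\Phi^k \prod_{j<n} (\Phi - b_j) H$. Hence $e \mid n!\,d$.

  The expansion of an element of $S$ in terms of the $G_n$ follows by successive elimination of leading
  terms. Conversely, preimages under $\Phi^r$ of the summands of $\sum_n c_n G_n$ can be chosen such that
  their coefficients tend to $0$ profinitely, so that they can be summed.
\<close>

section \<open>Divisibility in the ring of profinite integers\<close>

lemma zhat_rel_const [simp]: "zhat_rel (\<lambda>_. c) (\<lambda>_. c)"
  by (simp add: zhat_rel_def compatible_def)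

lemma of_int_zhat: "of_int k = abs_zhat (\<lambda>_. k)"
proof (cases "k \<ge> 0")
  case True
  then show ?thesis
    using of_nat_zhat [of "nat k"] by simp
next
  case False
  have "of_int k = - of_nat (nat (- k))"
    using False by simp
  also have "\<dots> = abs_zhat (\<lambda>_. - int (nat (- k)))"
    by (simp add: of_nat_zhat uminus_zhat.abs_eq)
  finally show ?thesis
    using False by simp
qed

text \<open>Reduces divisibility by m in the profinite integers to divisibility of a single integer,
  the component at m.\<close>

lemma of_nat_dvd_abs_zhat:
  assumes y: "zhat_rel y y" and m: "m > 0"
  shows "of_nat m dvd abs_zhat y \<longleftrightarrow> int m dvd y m"
proof
  assume "of_nat m dvd abs_zhat y"
  then obtain w where w: "abs_zhat y = of_nat m * w"
    by (elim dvdE)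
  obtain z where z: "zhat_rel z z" "w = abs_zhat z"
    by (rule zhat_repE)
  have rel: "zhat_rel (\<lambda>n. int m * z n) (\<lambda>n. int m * z n)"
    using z by (simp add: zhat_rel_def compatible_def cong_mult)
  have "abs_zhat y = abs_zhat (\<lambda>n. int m * z n)"
    using z by (simp add: w of_nat_zhat times_zhat.abs_eq)
  from abs_zhat_eqD [OF y rel this] have "[y m = int m * z m] (mod int m)"
    using m by (simp add: zhat_rel_def)
  then show "int m dvd y m"
    by (meson cong_dvd_iff dvd_triv_left)
next
  assume dvd: "int m dvd y m"
  have comp: "compatible y"
    using y by (simp add: zhat_rel_def)
  have dvd': "int m dvd y (m * n)" if "n > 0" for n
  proof -
    have "[y (m * n) = y m] (mod int m)"
      using comp m that by (simp add: compatible_def)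
    then show ?thesis
      using dvd cong_dvd_iff by blast
  qed
  \<comment> \<open>Dividing by m costs a factor m of precision, so the quotient modulo n is read
    off at index \<open>m * n\<close>.\<close>
  define z where "z = (\<lambda>n. y (m * n) div int m)"
  have z: "int m * z n = y (m * n)" if "n > 0" for n
    using dvd' [OF that] by (simp add: z_def)
  have "compatible z"
    unfolding compatible_def
  proof (intro allI impI)
    fix k n :: nat
    assume kn: "k > 0" "n > 0" "k dvd n"
    then have "[y (m * n) = y (m * k)] (mod int (m * k))"
      using comp m by (simp add: compatible_def del: of_nat_mult)
    then have "int m * int k dvd int m * (z n - z k)"
      using kn by (simp add: cong_iff_dvd_diff right_diff_distrib z)
    then show "[z n = z k] (mod int k)"
      using m by (simp add: cong_iff_dvd_diff)
  qed
  then have zz: "zhat_rel z z"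
    by (simp add: zhat_rel_def)
  have "zhat_rel y (\<lambda>n. int m * z n)"
    unfolding zhat_rel_def
  proof (intro conjI allI impI)
    show "compatible (\<lambda>n. int m * z n)"
      using \<open>compatible z\<close> by (simp add: compatible_def cong_mult)
    fix n :: nat assume "n > 0"
    then show "[y n = int m * z n] (mod int n)"
      using comp m by (simp add: z compatible_def cong_sym_eq)
  qed (rule comp)
  then have "abs_zhat y = of_nat m * abs_zhat z"
    using zz by (subst abs_zhat_eqI) (simp_all add: of_nat_zhat times_zhat.abs_eq)
  then show "of_nat m dvd abs_zhat y"
    by simp
qed

lemma of_nat_dvd_of_int_zhat:
  "m > 0 \<Longrightarrow> (of_nat m :: zhat) dvd of_int a \<longleftrightarrow> int m dvd a"
  by (simp add: of_int_zhat of_nat_dvd_abs_zhat)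

text \<open>Separatedness of the profinite topology: identities may be checked modulo every positive
  integer.\<close>

lemma zhat_eq_0I:
  fixes x :: zhat
  assumes "\<And>m. m > 0 \<Longrightarrow> of_nat m dvd x"
  shows "x = 0"
proof -
  obtain y where y: "zhat_rel y y" "x = abs_zhat y"
    by (rule zhat_repE)
  have "int m dvd y m" if "m > 0" for m
    using assms [OF that] y that by (simp add: of_nat_dvd_abs_zhat)
  with y(1) have "zhat_rel y (\<lambda>_. 0)"
    by (simp add: zhat_rel_def compatible_def cong_0_iff)
  then show ?thesis
    by (simp add: y zero_zhat_def abs_zhat_eqI)
qed

text \<open>Completeness: the way in which elements are built below from integer approximations
  modulo each m.\<close>

lemma zhat_compatibleE:
  assumes f: "compatible f"
  obtains x :: zhat where "\<And>m. m > 0 \<Longrightarrow> of_nat m dvd x - of_int (f m)"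
proof -
  have ff: "zhat_rel f f"
    using f by (simp add: zhat_rel_def)
  have "of_nat m dvd abs_zhat f - of_int (f m)" if "m > 0" for m
  proof -
    have "zhat_rel (\<lambda>n. f n - f m) (\<lambda>n. f n - f m)"
      using f by (simp add: zhat_rel_def compatible_def cong_diff)
    then have "of_nat m dvd abs_zhat (\<lambda>n. f n - f m)"
      using that by (subst of_nat_dvd_abs_zhat) auto
    then show ?thesis
      using ff by (simp add: of_int_zhat minus_zhat.abs_eq)
  qed
  then show thesis
    by (rule that)
qed

lemma zhat_approx_int:
  fixes x :: zhat
  assumes "m > 0"
  obtains a :: int where "of_nat m dvd x - of_int a"
proof -
  obtain y where y: "zhat_rel y y" "x = abs_zhat y"
    by (rule zhat_repE)
  then have c: "zhat_rel (\<lambda>n. y n - y m) (\<lambda>n. y n - y m)"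
    by (simp add: zhat_rel_def compatible_def cong_diff)
  have "of_nat m dvd abs_zhat (\<lambda>n. y n - y m)"
    using assms c by (simp add: of_nat_dvd_abs_zhat)
  then have "of_nat m dvd x - of_int (y m)"
    using y by (simp add: of_int_zhat minus_zhat.abs_eq)
  then show thesis
    by (rule that)
qed

lemma zhat_cancel_of_nat:
  fixes x y :: zhat
  assumes "k > 0" "of_nat k * x = of_nat k * y"
  shows "x = y"
  using zhat_torsion_free [of k "x - y"] assms by (simp add: right_diff_distrib)

section \<open>Euler's theorem for profinite units\<close>

lemma euler_theorem_int:
  fixes a :: int
  assumes m: "m > 0" and cop: "coprime a (int m)"
  shows "[a ^ totient m = 1] (mod int m)"
proof -
  define b where "b = nat (a mod int m)"
  have b: "int b = a mod int m"
    using m by (simp add: b_def)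
  have "coprime (int b) (int m)"
    using cop m by (simp add: b)
  then have "[b ^ totient m = 1] (mod m)"
    by (intro euler_theorem) simp
  then have "[int b ^ totient m = 1] (mod int m)"
    by (metis cong_int_iff of_nat_1 of_nat_power)
  moreover have "[a ^ totient m = int b ^ totient m] (mod int m)"
    by (intro cong_pow) (simp add: b cong_def)
  ultimately show ?thesis
    using cong_trans by blast
qed

text \<open>Modulo m, both a and its inverse are integers, so the integer x approximating a is prime
  to m and Euler's theorem applies to x. This lets negative powers of a unit be replaced modulo m by
  positive ones.\<close>

lemma dvd_unit_power_minus_one:
  fixes a :: zhat
  assumes unit: "a dvd 1" and m: "m > 0"
  shows "of_nat m dvd a ^ (totient m * r) - 1"
proof -
  obtain b where b: "a * b = 1"
    using unit by (metis dvdE)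
  obtain x where x: "of_nat m dvd a - of_int x"
    using m by (rule zhat_approx_int)
  obtain y where y: "of_nat m dvd b - of_int y"
    using m by (rule zhat_approx_int)
  have "of_nat m dvd (a - of_int x) * b + of_int x * (b - of_int y)"
    using x y by simp
  also have "\<dots> = of_int (1 - x * y)"
    by (simp add: algebra_simps b)
  finally have dvd: "int m dvd 1 - x * y"
    using m of_nat_dvd_of_int_zhat by blast
  have "coprime x (int m)"
  proof (rule coprimeI)
    fix c assume "c dvd x" "c dvd int m"
    then have "c dvd x * y + (1 - x * y)"
      using dvd by (meson dvd_add dvd_mult2 dvd_trans)
    then show "is_unit c" by simp
  qed
  then have "[(x ^ totient m) ^ r = 1 ^ r] (mod int m)"
    using m by (intro cong_pow euler_theorem_int)
  then have "int m dvd x ^ (totient m * r) - 1"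
    by (simp add: cong_iff_dvd_diff power_mult)
  then have "(of_nat m :: zhat) dvd of_int (x ^ (totient m * r) - 1)"
    using m by (simp only: of_nat_dvd_of_int_zhat)
  moreover have "a - of_int x dvd a ^ (totient m * r) - of_int x ^ (totient m * r)"
    by (simp add: power_diff_sumr2)
  then have "of_nat m dvd a ^ (totient m * r) - of_int x ^ (totient m * r)"
    using x dvd_trans by blast
  ultimately have "of_nat m dvd (a ^ (totient m * r) - of_int x ^ (totient m * r))
      + of_int (x ^ (totient m * r) - 1)"
    by (rule dvd_add [rotated])
  then show ?thesis by simp
qed


section \<open>Idempotents of the ring of profinite integers\<close>

lemma int_dvd_by_prime_powers:
  fixes x :: int
  assumes e: "e > 0" and "\<And>p. prime p \<Longrightarrow> int (p ^ multiplicity p e) dvd x"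
  shows "int e dvd x"
proof -
  have "e dvd nat \<bar>x\<bar>"
  proof (cases "x = 0")
    case False
    show ?thesis
    proof (rule multiplicity_le_imp_dvd)
      fix p :: nat assume p: "prime p"
      have "p ^ multiplicity p e dvd nat \<bar>x\<bar>"
        using assms(2) [OF p] by (metis dvd_abs_iff int_dvd_int_iff nat_0_le abs_ge_zero)
      then show "multiplicity p e \<le> multiplicity p (nat \<bar>x\<bar>)"
        using p False by (intro multiplicity_geI) auto
    qed (use e in auto)
  qed simp
  then show ?thesis
    by (metis dvd_abs_iff int_dvd_int_iff abs_ge_zero nat_0_le)
qed

text \<open>Let p^a be the exact power of p in m. If p divides N, then a < p^a <= m! makes N^(m!)
  vanish modulo p^a; otherwise totient(p^a) divides m! and Euler's theorem applies to the cofactor.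
  Hence the powers N^(m!) form a compatible family.\<close>

lemma power_fact_cong:
  assumes m: "m > 0" and t: "t > 0"
  shows "[int N ^ (fact m * t) = int N ^ fact m] (mod int m)"
  unfolding cong_iff_dvd_diff
proof (rule int_dvd_by_prime_powers)
  fix p :: nat assume p: "prime p"
  define a where "a = multiplicity p m"
  have pa: "p ^ a \<le> m"
    using m by (simp add: a_def dvd_imp_le multiplicity_dvd)
  have eq: "int N ^ (fact m * t) - int N ^ fact m = int N ^ fact m * (int N ^ (fact m * (t - 1)) - 1)"
    using t by (cases t) (simp_all add: algebra_simps power_add)
  show "int (p ^ multiplicity p m) dvd int N ^ (fact m * t) - int N ^ fact m"
  proof (cases "p dvd N")
    case True
    have "a < p ^ a"
      using p prime_gt_1_nat by (intro power_gt_expt) simp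
    also have "p ^ a \<le> fact m"
      using pa fact_ge_self le_trans by blast
    finally have "p ^ a dvd p ^ fact m"
      by (intro le_imp_power_dvd) simp
    also have "p ^ fact m dvd N ^ fact m"
      using True by (rule dvd_power_same)
    finally have "int (p ^ a) dvd int N ^ fact m"
      by (metis int_dvd_int_iff of_nat_power)
    then show ?thesis
      unfolding eq a_def by simp
  next
    case False
    have "totient (p ^ a) \<le> p ^ a"
      by (rule totient_le)
    then have "totient (p ^ a) \<le> m"
      using pa by simp
    then have "totient (p ^ a) dvd fact m"
      using p by (intro dvd_fact) (auto simp: prime_gt_0_nat Suc_le_eq)
    then obtain s where s: "fact m * (t - 1) = totient (p ^ a) * s"
      by (metis dvdE mult.assoc)
    have "coprime (int N) (int (p ^ a))"
      using False p by (metis coprime_int_iff coprime_power_right_iff prime_imp_coprime_nat coprime_commute)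
    then have "[(int N ^ totient (p ^ a)) ^ s = 1 ^ s] (mod int (p ^ a))"
      using p by (intro cong_pow euler_theorem_int) (auto simp: prime_gt_0_nat)
    then have "int (p ^ a) dvd int N ^ (fact m * (t - 1)) - 1"
      unfolding s by (simp add: cong_iff_dvd_diff power_mult)
    then show ?thesis
      unfolding eq a_def by simp
  qed
qed (rule m)

text \<open>
  The idempotent is $0$ in $\mathbf{Z}_p$ if $p$ divides $N$ and $1$ otherwise; modulo $m$ it is $N^{m!}$.
\<close>

lemma zhat_idempotentE:
  fixes N :: nat
  obtains \<epsilon> :: zhat where "\<epsilon> * \<epsilon> = \<epsilon>"
    and "\<And>k. k > 0 \<Longrightarrow> (\<And>p. prime p \<Longrightarrow> p dvd k \<Longrightarrow> p dvd N) \<Longrightarrow> of_nat k dvd \<epsilon>"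
    and "\<And>k. k > 0 \<Longrightarrow> coprime k N \<Longrightarrow> of_nat k dvd 1 - \<epsilon>"
proof -
  have "compatible (\<lambda>m. int N ^ fact m)"
    unfolding compatible_def
  proof (intro allI impI)
    fix m n :: nat assume mn: "m > 0" "n > 0" "m dvd n"
    then have "m \<le> n" by (simp add: dvd_imp_le)
    then have "fact m dvd (fact n :: nat)" by (rule fact_dvd)
    then obtain t :: nat where t: "fact n = fact m * t"
      by (elim dvdE)
    then have "t > 0"
      by (metis fact_nonzero mult_0_right neq0_conv)
    then show "[int N ^ fact n = int N ^ fact m] (mod int m)"
      unfolding t using mn by (intro power_fact_cong) auto
  qed
  then obtain \<epsilon> :: zhat where \<epsilon>: "\<And>m. m > 0 \<Longrightarrow> of_nat m dvd \<epsilon> - of_int (int N ^ fact m)"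
    by (rule zhat_compatibleE) blast
  have "\<epsilon> * \<epsilon> - \<epsilon> = 0"
  proof (rule zhat_eq_0I)
    fix m :: nat assume m: "m > 0"
    define x where "x = int N ^ fact m"
    \<comment> \<open>Squaring doubles the exponent, which is the case t = 2 of
      \<open>power_fact_cong\<close>.\<close>
    have "int m dvd x * x - x"
      using power_fact_cong [OF m, of 2 N]
      by (simp add: cong_iff_dvd_diff x_def power_mult power2_eq_square)
    then have "(of_nat m :: zhat) dvd of_int (x * x - x)"
      using m by (simp only: of_nat_dvd_of_int_zhat)
    moreover have "of_nat m dvd (\<epsilon> - of_int x) * (\<epsilon> + of_int x - 1)"
      using \<epsilon> [OF m] by (simp add: x_def)
    ultimately have "of_nat m dvd (\<epsilon> - of_int x) * (\<epsilon> + of_int x - 1) + of_int (x * x - x)"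
      by (rule dvd_add [rotated])
    then show "of_nat m dvd \<epsilon> * \<epsilon> - \<epsilon>"
      by (simp add: algebra_simps)
  qed
  then have idem: "\<epsilon> * \<epsilon> = \<epsilon>" by simp
  have smooth: "of_nat k dvd \<epsilon>" if k: "k > 0" and kN: "\<And>p. prime p \<Longrightarrow> p dvd k \<Longrightarrow> p dvd N" for k
  proof -
    have "int k dvd int N ^ fact k"
    proof (rule int_dvd_by_prime_powers [OF k])
      fix p :: nat assume p: "prime p"
      show "int (p ^ multiplicity p k) dvd int N ^ fact k"
      proof (cases "p dvd k")
        case True
        have "multiplicity p k < p ^ multiplicity p k"
          using p prime_gt_1_nat by (intro power_gt_expt) simp
        also have "\<dots> \<le> k"
          using k by (simp add: dvd_imp_le multiplicity_dvd)
        also have "k \<le> fact k"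
          by (rule fact_ge_self)
        finally have "p ^ multiplicity p k dvd p ^ fact k"
          by (intro le_imp_power_dvd) simp
        also have "p ^ fact k dvd N ^ fact k"
          using kN [OF p True] by (rule dvd_power_same)
        finally show ?thesis
          by (metis int_dvd_int_iff of_nat_power)
      qed (simp add: not_dvd_imp_multiplicity_0)
    qed
    then have "(of_nat k :: zhat) dvd of_int (int N ^ fact k)"
      using k by (simp only: of_nat_dvd_of_int_zhat)
    then have "of_nat k dvd (\<epsilon> - of_int (int N ^ fact k)) + of_int (int N ^ fact k)"
      using \<epsilon> [OF k] by (rule dvd_add [rotated])
    then show ?thesis by simp
  qed
  have cop: "of_nat k dvd 1 - \<epsilon>" if k: "k > 0" and kN: "coprime k N" for k
  proof -
    have "totient k dvd fact k"
      using k by (intro dvd_fact) (auto simp: totient_le Suc_le_eq)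
    then obtain s where s: "fact k = totient k * s"
      by (elim dvdE)
    have "coprime (int N) (int k)"
      using kN by (simp add: coprime_commute)
    then have "[(int N ^ totient k) ^ s = 1 ^ s] (mod int k)"
      using k by (intro cong_pow euler_theorem_int)
    then have "int k dvd int N ^ fact k - 1"
      unfolding s by (simp add: cong_iff_dvd_diff power_mult)
    then have "(of_nat k :: zhat) dvd of_int (int N ^ fact k - 1)"
      using k by (simp only: of_nat_dvd_of_int_zhat)
    then have "of_nat k dvd - (of_int (int N ^ fact k - 1) + (\<epsilon> - of_int (int N ^ fact k)))"
      using \<epsilon> [OF k] by (simp only: dvd_minus_iff dvd_add)
    then show ?thesis by simp
  qed
  show thesis
    using that idem smooth cop by blast
qed

text \<open>An idempotent splits the ring into two factors in which products are computed
  separately.\<close>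

lemma prod_idempotent_split:
  fixes \<epsilon> :: "'a :: comm_ring_1"
  assumes idem: "\<epsilon> * \<epsilon> = \<epsilon>"
  shows "(\<Prod>i\<in>I. \<epsilon> * x i + (1 - \<epsilon>) * y i) = \<epsilon> * (\<Prod>i\<in>I. x i) + (1 - \<epsilon>) * (\<Prod>i\<in>I. y i)"
proof -
  have *: "\<epsilon> * (\<epsilon> * x) = \<epsilon> * x" for x
    by (metis idem mult.assoc)
  have "(\<epsilon> * a + (1 - \<epsilon>) * b) * (\<epsilon> * c + (1 - \<epsilon>) * d) = \<epsilon> * (a * c) + (1 - \<epsilon>) * (b * d)" for a b c d
    by (simp add: algebra_simps idem *)
  then show ?thesis
    by (induction I rule: infinite_finite_induct) simp_all
qed


section \<open>Integers prime to a given prime\<close>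

text \<open>The \<open>j\<close>-th positive integer prime to \<open>p\<close>, counting from \<open>j = 0\<close>.\<close>

definition coprime_seq :: "nat \<Rightarrow> nat \<Rightarrow> nat" where
  "coprime_seq p j = p * (j div (p - 1)) + j mod (p - 1) + 1"

lemma coprime_seq_eq: "\<rho> < p - 1 \<Longrightarrow> coprime_seq p ((p - 1) * l + \<rho>) = p * l + \<rho> + 1"
  by (simp add: coprime_seq_def)

lemma coprime_seq_mod:
  assumes "p > 1"
  shows "coprime_seq p j mod p = j mod (p - 1) + 1"
proof -
  have "j mod (p - 1) + 1 < p"
    using assms mod_less_divisor [of "p - 1" j] by linarith
  then show ?thesis
    by (simp add: coprime_seq_def add.assoc)
qed

text \<open>Only the indices in one residue class modulo p - 1 yield factors divisible by p. These
  are p (m - l) with consecutive l, at least q of them, and q consecutive integers have product q!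
  times a binomial coefficient.\<close>

lemma prod_minus_coprime_seq_dvd:
  fixes r :: int and n :: nat
  assumes p: "prime p" and r: "\<not> int p dvd r"
  defines "q \<equiv> n div (p - 1)"
  shows "int (p ^ q * fact q) dvd (\<Prod>j<n. r - int (coprime_seq p j))"
proof -
  have p1: "p > 1" using p prime_gt_1_nat by blast
  \<comment> \<open>The shift by one reflects that entry j of \<open>coprime_seq p\<close> has
    residue \<open>j mod (p - 1) + 1\<close> modulo p.\<close>
  define \<rho> where "\<rho> = nat (r mod int p) - 1"
  define m where "m = r div int p"
  have pos: "r mod int p > 0"
    using r p1 by (metis dvd_eq_mod_eq_0 less_le of_nat_0_less_iff pos_mod_sign prime_gt_0_nat p)
  have lt: "r mod int p < int p"
    using p1 by simp
  have \<rho>: "\<rho> < p - 1"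
    using pos lt by (simp add: \<rho>_def)
  have "int \<rho> = r mod int p - 1"
    using pos by (simp add: \<rho>_def)
  then have r_eq: "r = int p * m + int \<rho> + 1"
    by (simp add: m_def)
  define h where "h = (\<lambda>l. (p - 1) * l + \<rho>)"
  have inj: "inj_on h {..<q}"
    using p1 by (auto simp: inj_on_def h_def)
  have sub: "h ` {..<q} \<subseteq> {..<n}"
  proof
    fix j assume "j \<in> h ` {..<q}"
    then obtain l where l: "l < q" "j = (p - 1) * l + \<rho>"
      by (auto simp: h_def)
    have "j < (p - 1) * Suc l"
      using \<rho> l by simp
    also have "\<dots> \<le> (p - 1) * q"
      using l by (intro mult_le_mono2) simp
    also have "\<dots> \<le> n"
      by (simp add: q_def)
    finally show "j \<in> {..<n}" by simp
  qed
  have "(\<Prod>j\<in>h ` {..<q}. r - int (coprime_seq p j)) = (\<Prod>l<q. int p * (m - int l))"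
    unfolding prod.reindex [OF inj] o_def
    by (intro prod.cong refl) (subst r_eq, simp only: h_def coprime_seq_eq [OF \<rho>], simp add: algebra_simps)
  also have "\<dots> = int p ^ q * (fact q * int_choose m q)"
    by (simp add: prod.distrib int_choose_mult_fact)
  finally have "int (p ^ q * fact q) dvd (\<Prod>j\<in>h ` {..<q}. r - int (coprime_seq p j))"
    by simp
  also have "\<dots> dvd (\<Prod>j<n. r - int (coprime_seq p j))"
    using sub by (intro prod_dvd_prod_subset) auto
  finally show ?thesis .
qed

text \<open>The factors below and above l multiply to l! and (L - l)! up to sign, and l! (L - l)!
  divides L!.\<close>

lemma prod_differences_dvd_fact:
  assumes "l \<le> L"
  shows "(\<Prod>i\<in>{..L} - {l}. int l - int i) dvd fact L"
proof -
  have split: "{..L} - {l} = {..<l} \<union> {l<..L}"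
    using assms by auto
  have "(\<Prod>i<l. int l - int i) = (\<Prod>i<l. int (Suc i))"
    by (rule prod.reindex_bij_witness [of _ "\<lambda>i. l - Suc i" "\<lambda>i. l - Suc i"]) auto
  also have "\<dots> = fact l"
    by (simp add: fact_prod_Suc lessThan_atLeast0)
  finally have 1: "(\<Prod>i<l. int l - int i) = fact l" .
  have "(\<Prod>i\<in>{l<..L}. int l - int i) = (\<Prod>i<L - l. - int (Suc i))"
    by (rule prod.reindex_bij_witness [of _ "\<lambda>i. l + Suc i" "\<lambda>i. i - Suc l"]) auto
  also have "\<dots> = (-1) ^ (L - l) * fact (L - l)"
    by (simp add: fact_prod_Suc lessThan_atLeast0 prod_uminus del: of_nat_Suc)
  finally have 2: "(\<Prod>i\<in>{l<..L}. int l - int i) = (-1) ^ (L - l) * fact (L - l)" .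
  have "(\<Prod>i\<in>{..L} - {l}. int l - int i) = (\<Prod>i<l. int l - int i) * (\<Prod>i\<in>{l<..L}. int l - int i)"
    unfolding split by (rule prod.union_disjoint) auto
  also have "\<dots> = (-1) ^ (L - l) * (fact l * fact (L - l))"
    by (simp add: 1 2)
  also have "\<dots> dvd fact L"
    using fact_fact_dvd_fact [of l "L - l", where 'a = int] assms
    by (cases "even (L - l)") simp_all
  finally show ?thesis .
qed

text \<open>Indices congruent to j modulo p - 1 contribute p times differences of integers from 0 to
  L, hence a divisor of p^L L!; all other factors are prime to p and are collected in y.\<close>

lemma prod_differences_coprime_seq_dvd:
  fixes n :: nat
  assumes p: "prime p" and j: "j \<le> n"
  defines "q \<equiv> n div (p - 1)"
  obtains y :: int where "\<not> int p dvd y"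
    and "(\<Prod>i\<in>{..n} - {j}. int (coprime_seq p j) - int (coprime_seq p i)) dvd int (p ^ q * fact q) * y"
proof -
  have p1: "p > 1" using p prime_gt_1_nat by blast
  define \<rho> where "\<rho> = j mod (p - 1)"
  define l where "l = j div (p - 1)"
  have \<rho>: "\<rho> < p - 1"
    using p1 by (simp add: \<rho>_def)
  have j_eq: "j = (p - 1) * l + \<rho>"
    by (simp add: l_def \<rho>_def)
  \<comment> \<open>The last position in the residue class of j; it is at most q, so p^L L! divides
    p^q q!.\<close>
  define L where "L = (n - \<rho>) div (p - 1)"
  define h where "h = (\<lambda>l. (p - 1) * l + \<rho>)"
  define C where "C = {i \<in> {..n} - {j}. i mod (p - 1) = \<rho>}"
  define X where "X = (\<Prod>i\<in>C. int (coprime_seq p j) - int (coprime_seq p i))"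
  define y where "y = (\<Prod>i\<in>{..n} - {j} - C. int (coprime_seq p j) - int (coprime_seq p i))"
  have \<rho>n: "\<rho> \<le> n" using j j_eq by simp
  have le_iff: "h k \<le> n \<longleftrightarrow> k \<le> L" for k
    using \<rho>n p1 by (auto simp: h_def L_def less_eq_div_iff_mult_less_eq mult.commute)
  have lL: "l \<le> L"
    using j j_eq le_iff by (simp add: h_def)
  have C: "C = h ` ({..L} - {l})"
  proof (intro equalityI subsetI)
    fix i assume i: "i \<in> C"
    then have i_eq: "i = h (i div (p - 1))"
      using mult_div_mod_eq [of "p - 1" i] by (simp add: C_def h_def)
    have "i \<le> n" "i \<noteq> j"
      using i by (auto simp: C_def)
    have "i div (p - 1) \<le> L"
      using \<open>i \<le> n\<close> i_eq le_iff by metis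
    moreover have "i div (p - 1) \<noteq> l"
      using \<open>i \<noteq> j\<close> i_eq j_eq unfolding h_def by metis
    ultimately show "i \<in> h ` ({..L} - {l})"
      using i_eq by blast
  next
    fix i assume "i \<in> h ` ({..L} - {l})"
    then show "i \<in> C"
      using le_iff \<rho> by (auto simp: C_def h_def j_eq)
  qed
  have inj: "inj_on h A" for A
    using p1 by (auto simp: inj_on_def h_def)
  have "X = (\<Prod>k\<in>{..L} - {l}. int p * (int l - int k))"
    unfolding X_def C prod.reindex [OF inj] o_def
    by (intro prod.cong refl) (subst j_eq, simp only: h_def coprime_seq_eq [OF \<rho>], simp add: algebra_simps)
  also have "\<dots> = int p ^ L * (\<Prod>k\<in>{..L} - {l}. int l - int k)"
    using lL by (simp add: prod.distrib)
  also have "\<dots> dvd int p ^ L * fact L"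
    using lL by (intro mult_dvd_mono dvd_refl prod_differences_dvd_fact)
  also have "\<dots> dvd int p ^ q * fact q"
    by (intro mult_dvd_mono le_imp_power_dvd fact_dvd) (auto simp: L_def q_def div_le_mono)
  finally have X: "X dvd int (p ^ q * fact q)"
    by simp
  have y: "\<not> int p dvd y"
  proof
    assume "int p dvd y"
    then obtain i where i: "i \<in> {..n} - {j} - C"
        and dvd: "int p dvd int (coprime_seq p j) - int (coprime_seq p i)"
      using p by (auto simp: y_def prime_dvd_prod_iff)
    have "[coprime_seq p j = coprime_seq p i] (mod p)"
      using dvd by (simp flip: cong_iff_dvd_diff cong_int_iff)
    then have "j mod (p - 1) = i mod (p - 1)"
      using p1 by (simp add: cong_def coprime_seq_mod)
    with i show False
      by (auto simp: C_def \<rho>_def)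
  qed
  have "(\<Prod>i\<in>{..n} - {j}. int (coprime_seq p j) - int (coprime_seq p i)) = X * y"
    unfolding X_def y_def by (subst mult.commute, rule prod.subset_diff) (auto simp: C_def)
  also have "\<dots> dvd int (p ^ q * fact q) * y"
    by (intro mult_dvd_mono X dvd_refl)
  finally show thesis
    using y that by blast
qed

text \<open>The factor n! cancels the negative term of \<open>d_val\<close>, so the product has the
  valuation that the prime-by-prime estimates produce.\<close>

lemma multiplicity_fact_mult_d_seq:
  fixes n :: nat
  assumes p: "prime p"
  defines "q \<equiv> n div (p - 1)"
  shows "multiplicity p (fact n * d_seq n) = multiplicity p (p ^ q * fact q :: nat)"
proof -
  have "multiplicity p (fact n * d_seq n) = multiplicity p (fact n :: nat) + multiplicity p (d_seq n)"
    using p d_seq_pos [of n] by (intro prime_elem_multiplicity_mult_distrib) auto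
  moreover have "multiplicity p (p ^ q * fact q :: nat) = q + multiplicity p (fact q :: nat)"
    using p by (subst prime_elem_multiplicity_mult_distrib) (auto simp: multiplicity_same_power)
  ultimately show ?thesis
    using multiplicity_d_seq [OF p, of n] by (simp add: d_val_def q_def)
qed

section \<open>Integers imitating \<open>coprime_seq p\<close> for all small primes at once\<close>

lemma p_ordering_cong:
  obtains b :: "nat \<Rightarrow> nat" where
    "\<And>j p. prime p \<Longrightarrow> p \<le> n + 2 \<Longrightarrow> [b j = coprime_seq p j] (mod p ^ M)"
proof -
  \<comment> \<open>The Chinese remainder theorem handles finitely many primes; primes beyond n + 2
    do not divide n! d_n.\<close>
  have "\<exists>x. \<forall>p\<in>{p. prime p \<and> p \<le> n + 2}. [x = coprime_seq p j] (mod p ^ M)" for j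
    by (rule chinese_remainder_nat) (auto simp: primes_coprime)
  then show thesis
    using that by simp metis
qed

text \<open>The second property serves the divisibility of leading coefficients, the third the
  existence of G_n. The factor r^e takes care of primes dividing r, as v_p(e) < e. The cofactor m
  absorbs primes beyond n + 2, at which the b_j are uncontrolled.\<close>

lemma simultaneous_p_ordering:
  fixes n :: nat
  defines "e \<equiv> fact n * d_seq n" and "N \<equiv> fact (n + 2) :: nat"
  obtains b :: "nat \<Rightarrow> nat" where "\<And>j. coprime (b j) N"
    and "\<And>r :: int. int e dvd r ^ e * (\<Prod>j<n. r - int (b j))"
    and "\<And>j. j \<le> n \<Longrightarrow> \<exists>m>0. coprime m N \<and> (\<Prod>i\<in>{..n} - {j}. int (b j) - int (b i)) dvd int e * int m"
proof -
  have e: "e > 0"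
    using d_seq_pos [of n] by (simp add: e_def)
  \<comment> \<open>This precision is ample: only exponents up to v_p(e) + 1 occur below, and v_p(e)
    < e.\<close>
  obtain b :: "nat \<Rightarrow> nat" where
    b: "\<And>j p. prime p \<Longrightarrow> p \<le> n + 2 \<Longrightarrow> [b j = coprime_seq p j] (mod p ^ Suc e)"
    using p_ordering_cong [of n "Suc e"] by blast
  have mult_less: "multiplicity p e < e" if "prime p" for p
  proof -
    have "multiplicity p e < p ^ multiplicity p e"
      using that prime_gt_1_nat by (intro power_gt_expt) simp
    also have "\<dots> \<le> e"
      using e by (simp add: dvd_imp_le multiplicity_dvd)
    finally show ?thesis .
  qed
  have b': "[int (b j) = int (coprime_seq p j)] (mod int (p ^ k))"
    if "prime p" "p \<le> n + 2" "k \<le> Suc e" for p j k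
  proof -
    have "p ^ k dvd p ^ Suc e"
      using that(3) by (rule le_imp_power_dvd)
    then have "[b j = coprime_seq p j] (mod p ^ k)"
      using b [OF that(1,2)] cong_dvd_modulus_nat by blast
    then show ?thesis
      by (simp only: cong_int_iff)
  qed
  have cop: "coprime (b j) N" for j
  proof (rule ccontr)
    assume "\<not> coprime (b j) N"
    then obtain p where p: "prime p" "p dvd b j" "p dvd N"
      by (metis coprime_iff_gcd_eq_1 dvd_trans gcd_dvd1 gcd_dvd2 prime_factor_nat)
    then have pn: "p \<le> n + 2"
      unfolding N_def using prime_dvd_fact_iff by blast
    have "[b j = coprime_seq p j] (mod p)"
      using b [OF p(1) pn] by (metis cong_dvd_modulus_nat dvd_power zero_less_Suc)
    then have "p dvd coprime_seq p j"
      using p(2) cong_dvd_iff by blast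
    then show False
      using coprime_seq_mod [of p j] prime_gt_1_nat [OF p(1)] by (simp add: dvd_eq_mod_eq_0)
  qed
  have vals: "int e dvd r ^ e * (\<Prod>j<n. r - int (b j))" for r :: int
  proof (rule int_dvd_by_prime_powers [OF e])
    fix p :: nat assume p: "prime p"
    define v where "v = multiplicity p e"
    have "int (p ^ v) dvd r ^ e * (\<Prod>j<n. r - int (b j))"
    proof (cases "int p dvd r")
      case True
      have "int p ^ v dvd int p ^ e"
        using mult_less [OF p] by (intro le_imp_power_dvd) (simp add: v_def)
      also have "\<dots> dvd r ^ e"
        using True by (rule dvd_power_same)
      finally show ?thesis by simp
    next
      case False
      define q where "q = n div (p - 1)"
      have v: "v = multiplicity p (p ^ q * fact q :: nat)"
        unfolding v_def e_def q_def by (rule multiplicity_fact_mult_d_seq [OF p])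
      show ?thesis
      proof (cases "p \<le> n + 2")
        case True
        have "int (p ^ v) dvd int (p ^ q * fact q)"
          unfolding v by (simp only: int_dvd_int_iff multiplicity_dvd)
        also have "\<dots> dvd (\<Prod>j<n. r - int (coprime_seq p j))"
          unfolding q_def using p False by (rule prod_minus_coprime_seq_dvd)
        finally have "int (p ^ v) dvd (\<Prod>j<n. r - int (coprime_seq p j))" .
        moreover have "[(\<Prod>j<n. r - int (b j)) = (\<Prod>j<n. r - int (coprime_seq p j))] (mod int (p ^ v))"
          using mult_less [OF p] by (intro cong_prod cong_diff cong_refl b' p True) (simp add: v_def)
        ultimately have "int (p ^ v) dvd (\<Prod>j<n. r - int (b j))"
          using cong_dvd_iff by blast
        then show ?thesis by simp
      next
        case False
        then have "q = 0" by (simp add: q_def)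
        then show ?thesis by (simp add: v)
      qed
    qed
    then show "int (p ^ multiplicity p e) dvd r ^ e * (\<Prod>j<n. r - int (b j))"
      by (simp only: v_def)
  qed
  have diffs: "\<exists>m>0. coprime m N \<and> (\<Prod>i\<in>{..n} - {j}. int (b j) - int (b i)) dvd int e * int m"
    if j: "j \<le> n" for j
  proof -
    define D where "D = (\<Prod>i\<in>{..n} - {j}. int (b j) - int (b i))"
    have not_dvd: "\<not> int (p ^ Suc (multiplicity p e)) dvd D" if p: "prime p" "p \<le> n + 2" for p
    proof
      define k where "k = Suc (multiplicity p e)"
      define q where "q = n div (p - 1)"
      have k: "k = Suc (multiplicity p (p ^ q * fact q :: nat))"
        unfolding k_def e_def q_def by (simp only: multiplicity_fact_mult_d_seq [OF p(1)])
      assume "int (p ^ Suc (multiplicity p e)) dvd D"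
      moreover have "[D = (\<Prod>i\<in>{..n} - {j}. int (coprime_seq p j) - int (coprime_seq p i))] (mod int (p ^ k))"
        unfolding D_def using mult_less [OF p(1)] by (intro cong_prod cong_diff b' p) (simp_all add: k_def)
      ultimately have dvd: "int (p ^ k) dvd (\<Prod>i\<in>{..n} - {j}. int (coprime_seq p j) - int (coprime_seq p i))"
        using cong_dvd_iff k_def by blast
      obtain y :: int where y: "\<not> int p dvd y"
        and "(\<Prod>i\<in>{..n} - {j}. int (coprime_seq p j) - int (coprime_seq p i)) dvd int (p ^ q * fact q) * y"
        unfolding q_def using p(1) j by (rule prod_differences_coprime_seq_dvd)
      with dvd have "int (p ^ k) dvd int (p ^ q * fact q) * y"
        using dvd_trans by blast
      moreover have "coprime (int (p ^ k)) y"
        using y p(1) by (simp add: prime_imp_coprime)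
      ultimately have "int (p ^ k) dvd int (p ^ q * fact q)"
        by (simp only: coprime_dvd_mult_left_iff)
      then have "p ^ k dvd p ^ q * fact q"
        by (simp only: int_dvd_int_iff)
      then have "k \<le> multiplicity p (p ^ q * fact q :: nat)"
        using p(1) by (intro multiplicity_geI) (auto simp: prime_gt_0_nat)
      then show False by (simp add: k)
    qed
    \<comment> \<open>The bound n + 2 admits the prime 2 even for n = 0, and 0 would be divisible by
      every power of 2.\<close>
    then have D0: "D \<noteq> 0"
      using not_dvd [OF two_is_prime_nat] by auto
    \<comment> \<open>For p <= n + 2 the full p-part of D divides e, hence already lies in g; the
      cofactor m is thus prime to p.\<close>
    define g where "g = gcd (nat \<bar>D\<bar>) e"
    define m where "m = nat \<bar>D\<bar> div g"
    have gm: "nat \<bar>D\<bar> = g * m"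
      by (simp add: m_def g_def)
    then have m0: "m > 0"
      using D0 by (cases m) auto
    have "coprime m N"
    proof (rule ccontr)
      assume "\<not> coprime m N"
      then obtain p where p: "prime p" "p dvd m" "p dvd N"
        by (metis coprime_iff_gcd_eq_1 dvd_trans gcd_dvd1 gcd_dvd2 prime_factor_nat)
      then have pn: "p \<le> n + 2"
        unfolding N_def using prime_dvd_fact_iff by blast
      define w where "w = multiplicity p (nat \<bar>D\<bar>)"
      have "w \<le> multiplicity p e"
      proof (rule ccontr)
        assume "\<not> w \<le> multiplicity p e"
        then have "p ^ Suc (multiplicity p e) dvd p ^ w"
          by (intro le_imp_power_dvd) simp
        also have "p ^ w dvd nat \<bar>D\<bar>"
          unfolding w_def by (rule multiplicity_dvd)
        finally show False
          using not_dvd [OF p(1) pn] by (metis abs_ge_zero dvd_abs_iff int_dvd_int_iff nat_0_le)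
      qed
      then have "p ^ w dvd e"
        by (rule multiplicity_dvd')
      moreover have "p ^ w dvd nat \<bar>D\<bar>"
        unfolding w_def by (rule multiplicity_dvd)
      ultimately have "p ^ w dvd g"
        unfolding g_def by (rule gcd_greatest [rotated])
      then have "p ^ Suc w dvd nat \<bar>D\<bar>"
        unfolding gm using p(2) by (metis mult.commute mult_dvd_mono power_Suc)
      then have "Suc w \<le> w"
        using p(1) D0 by (subst (2) w_def, intro multiplicity_geI) auto
      then show False by simp
    qed
    moreover have "g dvd e"
      unfolding g_def by (rule gcd_dvd2)
    then have "nat \<bar>D\<bar> dvd e * m"
      by (simp add: gm)
    then have "D dvd int e * int m"
      by (metis abs_dvd_iff abs_ge_zero int_dvd_int_iff nat_0_le of_nat_mult)
    ultimately show ?thesis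
      using m0 unfolding D_def by blast
  qed
  show thesis
    by (rule that [OF cop vals diffs])
qed


section \<open>The image of the powers of the operator\<close>

lemma Phi_nth: "Phi G $ i = of_nat i * G $ i - of_nat (Suc i) * G $ Suc i"
proof -
  have "Phi G = fps_X * fps_deriv G - fps_deriv G"
    by (simp add: Phi_def algebra_simps)
  then show ?thesis
    by (cases i) simp_all
qed

lemma Phi_pow_diff: "(Phi ^^ r) (F - G) = (Phi ^^ r) F - (Phi ^^ r) G"
proof (induction r)
  case (Suc r)
  show ?case
    by (simp only: funpow.simps o_apply Suc) (simp add: fps_eq_iff Phi_nth algebra_simps)
qed simp

lemma Phi_pow_add: "(Phi ^^ r) (F + G) = (Phi ^^ r) F + (Phi ^^ r) G"
proof (induction r)
  case (Suc r)
  show ?case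
    by (simp only: funpow.simps o_apply Suc) (simp add: fps_eq_iff Phi_nth algebra_simps)
qed simp

lemma Phi_pow_cmult: "(Phi ^^ r) (fps_const c * F) = fps_const c * (Phi ^^ r) F"
proof (induction r)
  case (Suc r)
  show ?case
    by (simp only: funpow.simps o_apply Suc) (simp add: fps_eq_iff Phi_nth algebra_simps)
qed simp

lemma Phi_pow_sum:
  "(Phi ^^ r) (\<Sum>i\<in>I. fps_const (c i) * F i) = (\<Sum>i\<in>I. fps_const (c i) * (Phi ^^ r) (F i))"
proof -
  have zero: "(Phi ^^ r) 0 = 0"
    using Phi_pow_diff [of r 0 0] by simp
  show ?thesis
    by (induction I rule: infinite_finite_induct) (simp_all add: zero Phi_pow_add Phi_pow_cmult)
qed

text \<open>Coefficient i of \<open>Phi G\<close> involves only coefficients i and i + 1 of G, so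
  each application loses at most one order of vanishing.\<close>

lemma Phi_pow_nth_eq_0:
  assumes "\<And>i. i < n \<Longrightarrow> F $ i = 0" and "i + k < n"
  shows "(Phi ^^ k) F $ i = 0"
  using assms(2)
proof (induction k arbitrary: i)
  case (Suc k)
  then show ?case using Suc.IH [of i] Suc.IH [of "Suc i"] by (simp add: Phi_nth)
qed (use assms(1) in simp)

lemma Phi_pow_A_series: "(Phi ^^ k) (A_series a) = fps_const (a ^ k) * A_series a"
proof (induction k)
  case (Suc k)
  \<comment> \<open>The usual recursion, proved after multiplication by i!, which torsion-freeness
    allows to cancel. It turns the coefficient formula for Phi into the eigenvalue equation.\<close>
  have rec: "of_nat (Suc i) * zhat_choose a (Suc i) = (a - of_nat i) * zhat_choose a i" for i
  proof (rule zhat_cancel_of_nat)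
    show "of_nat (fact i) * (of_nat (Suc i) * zhat_choose a (Suc i))
        = of_nat (fact i) * ((a - of_nat i) * zhat_choose a i)"
      using zhat_choose_mult_fact [of "Suc i" a] zhat_choose_mult_fact [of i a]
      by (simp add: algebra_simps)
  qed simp
  have "Phi (A_series a) = fps_const a * A_series a"
  proof (rule fps_ext)
    fix i
    have "Phi (A_series a) $ i
        = (-1) ^ i * (of_nat i * zhat_choose a i + of_nat (Suc i) * zhat_choose a (Suc i))"
      by (simp add: Phi_nth A_series_def algebra_simps)
    also have "\<dots> = (fps_const a * A_series a) $ i"
      unfolding rec by (simp add: A_series_def algebra_simps)
    finally show "Phi (A_series a) $ i = (fps_const a * A_series a) $ i" .
  qed
  moreover have "Phi (fps_const (a ^ k) * A_series a) = fps_const (a ^ k) * Phi (A_series a)"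
    using Phi_pow_cmult [of 1] by simp
  ultimately show ?case
    by (simp add: Suc mult_ac flip: fps_const_mult)
qed simp

section \<open>Leading terms and membership in S\<close>

lemma cong_monom_iff: "cong_monom F c n \<longleftrightarrow> (\<forall>i<n. F $ i = 0) \<and> F $ n = c"
proof -
  define H where "H = F - fps_const c * fps_X ^ n"
  have "fps_X ^ (n + 1) dvd H \<longleftrightarrow> (\<forall>i<n + 1. H $ i = 0)"
  proof
    assume "fps_X ^ (n + 1) dvd H"
    then obtain K where "H = fps_X ^ (n + 1) * K" by (elim dvdE)
    then show "\<forall>i<n + 1. H $ i = 0"
      by (simp only: fps_X_power_mult_nth) simp
  next
    assume "\<forall>i<n + 1. H $ i = 0"
    then have "H = fps_X ^ (n + 1) * fps_shift (n + 1) H"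
      by (intro fps_ext) (simp only: fps_X_power_mult_nth fps_shift_nth, simp)
    then show "fps_X ^ (n + 1) dvd H"
      by (metis dvd_triv_left)
  qed
  moreover have "H $ i = F $ i - (if i = n then c else 0)" for i
    by (simp add: H_def)
  ultimately show ?thesis
    unfolding cong_monom_def H_def [symmetric] by (auto simp: less_Suc_eq)
qed

lemma is_G_nth_less: "is_G n G \<Longrightarrow> i < n \<Longrightarrow> G $ i = 0"
  and is_G_nth_self: "is_G n G \<Longrightarrow> G $ n = of_nat (d_seq n)"
  by (simp_all add: is_G_def cong_monom_iff)

lemma in_S_set_iff: "F \<in> S_set \<longleftrightarrow> (\<forall>r\<ge>1. \<exists>H. F = (Phi ^^ r) H)"
  unfolding S_set_def by blast

lemma S_set_diff:
  assumes "F \<in> S_set" "G \<in> S_set"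
  shows "F - G \<in> S_set"
  unfolding in_S_set_iff
proof (intro allI impI)
  fix r :: nat assume "r \<ge> 1"
  then obtain H K where "F = (Phi ^^ r) H" "G = (Phi ^^ r) K"
    using assms unfolding in_S_set_iff by blast
  then have "F - G = (Phi ^^ r) (H - K)"
    by (simp only: Phi_pow_diff)
  then show "\<exists>H. F - G = (Phi ^^ r) H" ..
qed

lemma S_set_cmult:
  assumes "F \<in> S_set"
  shows "fps_const c * F \<in> S_set"
  unfolding in_S_set_iff
proof (intro allI impI)
  fix r :: nat assume "r \<ge> 1"
  then obtain H where "F = (Phi ^^ r) H"
    using assms unfolding in_S_set_iff by blast
  then have "fps_const c * F = (Phi ^^ r) (fps_const c * H)"
    by (simp only: Phi_pow_cmult)
  then show "\<exists>H'. fps_const c * F = (Phi ^^ r) H'" ..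
qed

text \<open>
  For $G = \sum_i c_i A_{a_i}$ the preimage is $H = \sum_i c_i a_i^{-r} A_{a_i}$. By Euler's theorem it is
  congruent modulo $m$ to $\Phi^{\varphi(m) r - r}(G)$, whose first coefficients vanish.
\<close>

lemma is_G_preimage:
  assumes G: "is_G n G"
  obtains H where "(Phi ^^ r) H = G"
    and "\<And>i m. m > 0 \<Longrightarrow> i + totient m * r < n \<Longrightarrow> of_nat m dvd H $ i"
proof -
  from G obtain a c where unit: "\<And>i. i \<in> {1..n+1} \<Longrightarrow> a i dvd 1"
    and G_eq: "G = (\<Sum>i=1..n+1. fps_const (c i) * A_series (a i))"
    unfolding is_G_def by blast
  define b where "b = (\<lambda>i. SOME b. a i * b = 1)"
  have b: "a i * b i = 1" if "i \<in> {1..n+1}" for i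
    unfolding b_def by (rule someI_ex) (use unit [OF that] in \<open>metis dvdE\<close>)
  define H where "H = (\<Sum>i=1..n+1. fps_const (c i * b i ^ r) * A_series (a i))"
  have "(Phi ^^ r) H = G"
    unfolding H_def Phi_pow_sum Phi_pow_A_series G_eq
  proof (rule sum.cong [OF refl])
    fix i assume i: "i \<in> {1..n+1}"
    have "c i * b i ^ r * a i ^ r = c i"
    proof -
      have "c i * b i ^ r * a i ^ r = c i * (a i * b i) ^ r"
        by (simp add: power_mult_distrib algebra_simps)
      then show ?thesis
        using b [OF i] by simp
    qed
    then show "fps_const (c i * b i ^ r) * (fps_const (a i ^ r) * A_series (a i)) = fps_const (c i) * A_series (a i)"
      by (simp flip: mult.assoc)
  qed
  moreover have "of_nat m dvd H $ j" if m: "m > 0" and j: "j + totient m * r < n" for j m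
  proof -
    define E where "E = totient m * r"
    have rE: "r \<le> E"
      using m by (simp add: E_def Suc_le_eq)
    have "(Phi ^^ (E - r)) G $ j = 0"
      using is_G_nth_less [OF G] j by (intro Phi_pow_nth_eq_0 [of n]) (auto simp: E_def)
    then have "H $ j = (H - (Phi ^^ (E - r)) G) $ j"
      by simp
    also have "\<dots> = (\<Sum>i=1..n+1. c i * (b i ^ r - a i ^ (E - r)) * A_series (a i) $ j)"
      unfolding H_def G_eq Phi_pow_sum Phi_pow_A_series
      by (simp add: fps_sum_nth algebra_simps flip: sum_subtractf)
    also have "of_nat m dvd \<dots>"
    proof (rule dvd_sum)
      fix i assume i: "i \<in> {1..n+1}"
      have "b i ^ r * a i ^ E = a i ^ (E - r)"
      proof -
        have "b i ^ r * (a i ^ r * a i ^ (E - r)) = (a i * b i) ^ r * a i ^ (E - r)"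
          by (simp add: power_mult_distrib algebra_simps)
        then show ?thesis
          using rE b [OF i] by (simp flip: power_add)
      qed
      then have "b i ^ r - a i ^ (E - r) = - (b i ^ r * (a i ^ E - 1))"
        by (simp add: algebra_simps)
      moreover have "of_nat m dvd a i ^ E - 1"
        unfolding E_def using unit [OF i] m by (rule dvd_unit_power_minus_one)
      ultimately show "of_nat m dvd c i * (b i ^ r - a i ^ (E - r)) * A_series (a i) $ j"
        by simp
    qed
    finally show ?thesis .
  qed
  ultimately show thesis
    by (rule that)
qed

lemma is_G_in_S_set:
  assumes "is_G n G"
  shows "G \<in> S_set"
  unfolding in_S_set_iff
proof (intro allI impI)
  fix r
  show "\<exists>H. G = (Phi ^^ r) H"
    using assms by (rule is_G_preimage [of _ _ r]) blast
qed


section \<open>Infinite linear combinations\<close>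

text \<open>Summed preimages converge coefficientwise only in this profinite sense, whereas x-adic
  convergence would make each coefficient eventually constant.\<close>

definition profinite_lim :: "(nat \<Rightarrow> zhat) \<Rightarrow> zhat \<Rightarrow> bool" where
  "profinite_lim x s \<longleftrightarrow> (\<forall>m>0. eventually (\<lambda>k. of_nat m dvd x k - s) sequentially)"

lemma profinite_lim_unique:
  assumes "profinite_lim x s" "profinite_lim x t"
  shows "s = t"
proof -
  have "s - t = 0"
  proof (rule zhat_eq_0I)
    fix m :: nat assume "m > 0"
    then have "eventually (\<lambda>k. of_nat m dvd x k - s \<and> of_nat m dvd x k - t) sequentially"
      using assms by (simp add: profinite_lim_def eventually_conj)
    then obtain k where "of_nat m dvd x k - s" "of_nat m dvd x k - t"
      by (auto simp: eventually_sequentially)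
    then have "of_nat m dvd (x k - t) - (x k - s)"
      by (simp only: dvd_diff)
    then show "of_nat m dvd s - t" by simp
  qed
  then show ?thesis by simp
qed

lemma profinite_lim_eventually:
  assumes "eventually (\<lambda>k. x k = s) sequentially"
  shows "profinite_lim x s"
  unfolding profinite_lim_def
proof (intro allI impI)
  fix m :: nat
  show "eventually (\<lambda>k. of_nat m dvd x k - s) sequentially"
    using assms by (rule eventually_mono) simp
qed

lemma profinite_lim_diff_cmult:
  assumes "profinite_lim x s" "profinite_lim y t"
  shows "profinite_lim (\<lambda>k. a * x k - b * y k) (a * s - b * t)"
  unfolding profinite_lim_def
proof (intro allI impI)
  fix m :: nat assume "m > 0"
  then have "eventually (\<lambda>k. of_nat m dvd x k - s \<and> of_nat m dvd y k - t) sequentially"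
    using assms by (simp add: profinite_lim_def eventually_conj)
  then show "eventually (\<lambda>k. of_nat m dvd a * x k - b * y k - (a * s - b * t)) sequentially"
  proof (rule eventually_mono)
    fix k assume "of_nat m dvd x k - s \<and> of_nat m dvd y k - t"
    then have "of_nat m dvd a * (x k - s) - b * (y k - t)"
      by (simp add: dvd_diff)
    then show "of_nat m dvd a * x k - b * y k - (a * s - b * t)"
      by (simp add: algebra_simps)
  qed
qed

text \<open>As in any complete ring topologized by ideals, terms tending to 0 suffice. Beyond K m
  the partial sums are constant modulo m; integers representing these constants form the compatible
  family that defines the sum.\<close>

lemma profinite_lim_series:
  assumes z: "\<And>m. m > 0 \<Longrightarrow> eventually (\<lambda>k. of_nat m dvd z k) sequentially"
  obtains s where "profinite_lim (\<lambda>K. \<Sum>k<K. z k) s"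
proof -
  have "\<exists>K. \<forall>k\<ge>K. of_nat m dvd z k" if "m > 0" for m
    using z [OF that] by (simp add: eventually_sequentially)
  then obtain K where K: "\<And>m k. m > 0 \<Longrightarrow> k \<ge> K m \<Longrightarrow> of_nat m dvd z k"
    by metis
  have tail: "of_nat m dvd (\<Sum>k<L. z k) - (\<Sum>k<K m. z k)" if m: "m > 0" and L: "L \<ge> K m" for m L
  proof -
    have "(\<Sum>k<L. z k) - (\<Sum>k<K m. z k) = (\<Sum>k\<in>{..<L} - {..<K m}. z k)"
      using L by (subst sum_diff) auto
    also have "of_nat m dvd \<dots>"
      using K [OF m] by (intro dvd_sum) auto
    finally show ?thesis .
  qed
  have "\<exists>a. of_nat m dvd (\<Sum>k<K m. z k) - of_int a" if "m > 0" for m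
    using that by (rule zhat_approx_int) blast
  then obtain f where f: "\<And>m. m > 0 \<Longrightarrow> of_nat m dvd (\<Sum>k<K m. z k) - of_int (f m)"
    by metis
  have f': "of_nat m dvd (\<Sum>k<L. z k) - of_int (f m)" if m: "m > 0" and L: "L \<ge> K m" for m L
    using dvd_add [OF tail [OF m L] f [OF m]] by simp
  have "compatible f"
    unfolding compatible_def
  proof (intro allI impI)
    fix m n :: nat assume mn: "m > 0" "n > 0" "m dvd n"
    define L where "L = max (K m) (K n)"
    have "(of_nat m :: zhat) dvd of_nat n"
      using mn(3) by (auto elim!: dvdE)
    also have "of_nat n dvd (\<Sum>k<L. z k) - of_int (f n)"
      using mn by (intro f') (auto simp: L_def)
    finally have "of_nat m dvd (\<Sum>k<L. z k) - of_int (f n)" .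
    moreover have "of_nat m dvd (\<Sum>k<L. z k) - of_int (f m)"
      using mn by (intro f') (auto simp: L_def)
    ultimately have "of_nat m dvd ((\<Sum>k<L. z k) - of_int (f m)) - ((\<Sum>k<L. z k) - of_int (f n))"
      by (simp only: dvd_diff)
    then have "(of_nat m :: zhat) dvd of_int (f n - f m)"
      by simp
    then show "[f n = f m] (mod int m)"
      using mn by (simp only: of_nat_dvd_of_int_zhat cong_iff_dvd_diff)
  qed
  then obtain s :: zhat where s: "\<And>m. m > 0 \<Longrightarrow> of_nat m dvd s - of_int (f m)"
    by (rule zhat_compatibleE) blast
  have "profinite_lim (\<lambda>K. \<Sum>k<K. z k) s"
    unfolding profinite_lim_def eventually_sequentially
  proof (intro allI impI exI)
    fix m L assume "m > 0" "L \<ge> K m"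
    then have "of_nat m dvd ((\<Sum>k<L. z k) - of_int (f m)) - (s - of_int (f m))"
      using f' s by (simp only: dvd_diff)
    then show "of_nat m dvd (\<Sum>k<L. z k) - s" by simp
  qed
  then show thesis by (rule that)
qed

text \<open>Phi is continuous, each coefficient of \<open>Phi G\<close> being a fixed linear
  combination of two coefficients of G.\<close>

lemma profinite_lim_Phi_pow:
  assumes "\<And>i. profinite_lim (\<lambda>k. X k $ i) (H $ i)"
  shows "profinite_lim (\<lambda>k. (Phi ^^ r) (X k) $ i) ((Phi ^^ r) H $ i)"
proof (induction r arbitrary: i)
  case (Suc r)
  show ?case
    by (simp add: Phi_nth del: of_nat_Suc) (intro profinite_lim_diff_cmult Suc)
qed (use assms in simp)

lemma G_combination_in_S_set:
  assumes G: "\<And>k. is_G k (G k)" and F: "(\<lambda>k. fps_const (c k) * G k) sums F"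
  shows "F \<in> S_set"
proof -
  have "F \<in> range (Phi ^^ r)" for r
  proof -
    have "\<exists>H. (Phi ^^ r) H = G k \<and>
        (\<forall>i m. m > 0 \<longrightarrow> i + totient m * r < k \<longrightarrow> of_nat m dvd H $ i)" for k
      using G [of k] by (rule is_G_preimage [of _ _ r]) blast
    then obtain H where H: "\<And>k. (Phi ^^ r) (H k) = G k"
      and dvd: "\<And>k i m. m > 0 \<Longrightarrow> i + totient m * r < k \<Longrightarrow> of_nat m dvd H k $ i"
      by metis
    have "\<exists>s. profinite_lim (\<lambda>K. \<Sum>k<K. c k * H k $ i) s" for i
    proof (rule profinite_lim_series)
      fix m :: nat assume "m > 0"
      \<comment> \<open>From k > i + totient m * r on, m divides coefficient i of the preimage
        \<open>H k\<close>.\<close>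
      then show "eventually (\<lambda>k. of_nat m dvd c k * H k $ i) sequentially"
        unfolding eventually_sequentially
        by (intro exI [of _ "Suc (i + totient m * r)"]) (auto intro!: dvd_mult dvd)
    qed blast
    then obtain h where h: "\<And>i. profinite_lim (\<lambda>K. \<Sum>k<K. c k * H k $ i) (h i)"
      by metis
    define X where "X = (\<lambda>K. \<Sum>k<K. fps_const (c k) * H k)"
    \<comment> \<open>The images of the partial sums \<open>X K\<close> tend to the left side by
      continuity and to the right side because their coefficients are eventually those of F.\<close>
    have "(Phi ^^ r) (Abs_fps h) $ i = F $ i" for i
    proof (rule profinite_lim_unique)
      show "profinite_lim (\<lambda>K. (Phi ^^ r) (X K) $ i) ((Phi ^^ r) (Abs_fps h) $ i)"
        using h by (intro profinite_lim_Phi_pow) (simp add: X_def fps_sum_nth)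
      have "(Phi ^^ r) (X K) = (\<Sum>k<K. fps_const (c k) * G k)" for K
        unfolding X_def Phi_pow_sum H ..
      then show "profinite_lim (\<lambda>K. (Phi ^^ r) (X K) $ i) (F $ i)"
        using F by (intro profinite_lim_eventually) (simp add: sums_def tendsto_fps_iff)
    qed
    then show ?thesis
      by (metis fps_ext rangeI)
  qed
  then show ?thesis
    by (simp add: S_set_def)
qed


section \<open>Divisibility of leading coefficients\<close>

text \<open>A monic polynomial in Phi encoded by the list of its roots; zero entries account for
  powers of Phi.\<close>

definition Phi_shifts :: "zhat list \<Rightarrow> zhat fps \<Rightarrow> zhat fps" where
  "Phi_shifts bs F = foldr (\<lambda>b F. Phi F - fps_const b * F) bs F"

lemma Phi_shifts_Nil [simp]: "Phi_shifts [] F = F"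
  and Phi_shifts_Cons_nth [simp]:
    "Phi_shifts (b # bs) F $ i = of_nat i * Phi_shifts bs F $ i
       - of_nat (Suc i) * Phi_shifts bs F $ Suc i - b * Phi_shifts bs F $ i"
  by (simp_all add: Phi_shifts_def Phi_nth)

lemma Phi_shifts_append_replicate:
  "Phi_shifts (bs @ replicate k 0) F = Phi_shifts bs ((Phi ^^ k) F)"
proof -
  have "foldr (\<lambda>b F. Phi F - fps_const b * F) (replicate k 0) F = (Phi ^^ k) F"
    by (induction k) simp_all
  then show ?thesis by (simp add: Phi_shifts_def)
qed

lemma Phi_shifts_add: "Phi_shifts bs (F + G) = Phi_shifts bs F + Phi_shifts bs G"
proof (induction bs)
  case (Cons b bs)
  show ?case
    by (rule fps_ext) (simp only: Phi_shifts_Cons_nth Cons.IH fps_add_nth fps_mult_left_const_nth,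
        simp add: algebra_simps)
qed simp

lemma Phi_shifts_cmult: "Phi_shifts bs (fps_const c * F) = fps_const c * Phi_shifts bs F"
proof (induction bs)
  case (Cons b bs)
  show ?case
    by (rule fps_ext) (simp only: Phi_shifts_Cons_nth Cons.IH fps_add_nth fps_mult_left_const_nth,
        simp add: algebra_simps)
qed simp

lemma Phi_shifts_sum:
  "Phi_shifts bs (\<Sum>i\<in>I. fps_const (c i) * F i) = (\<Sum>i\<in>I. fps_const (c i) * Phi_shifts bs (F i))"
proof -
  have zero: "Phi_shifts bs 0 = 0"
    using Phi_shifts_cmult [of bs 0 0] by simp
  show ?thesis
    by (induction I rule: infinite_finite_induct) (simp_all add: zero Phi_shifts_add Phi_shifts_cmult)
qed

text \<open>(1 - x)^r is an eigenvector of Phi with eigenvalue r, so a polynomial in Phi multiplies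
  it by its value at r.\<close>

lemma Phi_shifts_power:
  "Phi_shifts bs ((1 - fps_X) ^ r) = fps_const (\<Prod>b\<leftarrow>bs. of_nat r - b) * (1 - fps_X) ^ r"
proof (induction bs)
  case (Cons b bs)
  have Phi: "Phi ((1 - fps_X) ^ r) = fps_const (of_nat r) * (1 - fps_X) ^ r"
  proof (cases r)
    case 0
    then show ?thesis by (simp add: Phi_def)
  next
    case (Suc s)
    have "Phi ((1 - fps_X) ^ Suc s)
        = (fps_X - 1) * (fps_const (of_nat (Suc s)) * fps_deriv (1 - fps_X) * (1 - fps_X) ^ s)"
      unfolding Phi_def fps_deriv_power by simp
    also have "\<dots> = fps_const (of_nat (Suc s)) * (1 - fps_X) ^ Suc s"
    proof -
      have "(x - 1) * (a * -1 * P) = a * ((1 - x) * P)" for x a P :: "zhat fps"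
        by (simp add: algebra_simps)
      moreover have "fps_deriv (1 - fps_X :: zhat fps) = -1"
        by simp
      ultimately show ?thesis
        by (simp only: power_Suc)
    qed
    finally show ?thesis
      by (simp only: Suc)
  qed
  have "Phi_shifts (b # bs) ((1 - fps_X) ^ r)
      = Phi (Phi_shifts bs ((1 - fps_X) ^ r)) - fps_const b * Phi_shifts bs ((1 - fps_X) ^ r)"
    by (simp add: Phi_shifts_def)
  also have "\<dots> = fps_const (\<Prod>b\<leftarrow>bs. of_nat r - b) * Phi ((1 - fps_X) ^ r)
      - fps_const b * Phi_shifts bs ((1 - fps_X) ^ r)"
    unfolding Cons using Phi_pow_cmult [of 1] by simp
  also have "\<dots> = fps_const (of_nat r - b) * fps_const (\<Prod>b\<leftarrow>bs. of_nat r - b) * (1 - fps_X) ^ r"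
    unfolding Cons Phi fps_const_sub [symmetric] by (simp only: algebra_simps)
  finally show ?case by simp
qed simp

lemma Phi_shifts_nth_eq_0:
  assumes "\<And>i. i < n \<Longrightarrow> F $ i = 0" and "i + length bs < n"
  shows "Phi_shifts bs F $ i = 0"
  using assms(2)
proof (induction bs arbitrary: i)
  case (Cons b bs)
  then show ?case using Cons.IH [of i] Cons.IH [of "Suc i"] by simp
qed (use assms(1) in simp)

text \<open>If coefficient k of a series vanishes, then Phi - b turns its coefficient k + 1 into -(k
  + 1) times itself at position k. The factorials record these factors.\<close>

lemma Phi_shifts_leading:
  assumes zero: "\<And>i. i < n \<Longrightarrow> F $ i = 0" and "length bs \<le> n"
  shows "of_nat (fact (n - length bs)) * Phi_shifts bs F $ (n - length bs)
    = (-1) ^ length bs * of_nat (fact n) * F $ n"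
  using assms(2)
proof (induction bs)
  case (Cons b bs)
  define k where "k = n - length (b # bs)"
  have k: "n - length bs = Suc k"
    using Cons.prems by (simp add: k_def)
  have "Phi_shifts bs F $ k = 0"
    using Cons.prems by (intro Phi_shifts_nth_eq_0 [OF zero]) (auto simp: k_def)
  then have "of_nat (fact k) * Phi_shifts (b # bs) F $ k
      = - (of_nat (fact (Suc k)) * Phi_shifts bs F $ Suc k)"
    by (simp add: algebra_simps)
  also have "\<dots> = (-1) ^ length (b # bs) * of_nat (fact n) * F $ n"
    using Cons by (simp add: k)
  finally show ?case
    by (simp only: k_def)
qed simp

text \<open>
  Modulo a high power of $x$, the series $H$ is a combination of the eigenvectors $(1 - x)^r$ with
  $r \in \mathbf{N}$.
\<close>

lemma dvd_Phi_shifts_nth_0: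
  assumes "\<And>r :: nat. e dvd (\<Prod>b\<leftarrow>bs. of_nat r - b)"
  shows "e dvd Phi_shifts bs H $ 0"
proof -
  define D where "D = length bs"
  \<comment> \<open>With D factors applied, the constant term depends only on the coefficients of H
    up to degree D.\<close>
  define P where "P = (\<Sum>i\<le>D. fps_const (H $ i) * fps_X ^ i)"
  have "Phi_shifts bs (H - P) $ 0 = 0"
    by (rule Phi_shifts_nth_eq_0 [of "Suc D"])
       (auto simp: P_def D_def fps_sum_nth if_distrib [of "\<lambda>x. _ * x"] cong: if_cong)
  then have "Phi_shifts bs H $ 0 = Phi_shifts bs P $ 0"
    using Phi_shifts_add [of bs "H - P" P] by simp
  also have "\<dots> = (\<Sum>i\<le>D. H $ i * Phi_shifts bs (fps_X ^ i) $ 0)"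
    unfolding P_def Phi_shifts_sum by (simp add: fps_sum_nth)
  also have "e dvd \<dots>"
  proof (intro dvd_sum dvd_mult)
    fix i
    have "fps_X ^ i = ((- (1 - fps_X)) + 1 :: zhat fps) ^ i"
      by simp
    also have "\<dots> = (\<Sum>r\<le>i. of_nat (i choose r) * (- (1 - fps_X)) ^ r)"
      unfolding binomial_ring by simp
    also have "\<dots> = (\<Sum>r\<le>i. fps_const (of_nat (i choose r) * (-1) ^ r) * (1 - fps_X) ^ r)"
      by (intro sum.cong refl, subst power_minus)
         (simp add: fps_of_nat flip: fps_const_mult fps_const_power fps_const_neg)
    finally have X: "fps_X ^ i = (\<Sum>r\<le>i. fps_const (of_nat (i choose r) * (-1) ^ r) * (1 - fps_X :: zhat fps) ^ r)" .
    have "Phi_shifts bs (fps_X ^ i) $ 0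
        = (\<Sum>r\<le>i. of_nat (i choose r) * (-1) ^ r * (\<Prod>b\<leftarrow>bs. of_nat r - b))"
      unfolding X Phi_shifts_sum Phi_shifts_power by (simp add: fps_sum_nth fps_nth_power_0)
    then show "e dvd Phi_shifts bs (fps_X ^ i) $ 0"
      using assms by (simp add: dvd_sum dvd_mult)
  qed
  finally show ?thesis .
qed

lemma d_seq_dvd_leading_coeff:
  assumes "F \<in> S_set" "cong_monom F d n"
  shows "of_nat (d_seq n) dvd d"
proof -
  define e where "e = fact n * d_seq n"
  have e: "e \<ge> 1"
    using d_seq_pos [of n] by (simp add: e_def Suc_le_eq)
  obtain b :: "nat \<Rightarrow> nat" where b: "\<And>r :: int. int e dvd r ^ e * (\<Prod>j<n. r - int (b j))"
    by (rule simultaneous_p_ordering [of n], rule that, simp only: e_def)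
  \<comment> \<open>Taking an e-fold preimage supplies the factor r^e in the polynomial whose
    integer values are divisible by e.\<close>
  obtain H where H: "F = (Phi ^^ e) H"
    using assms(1) e unfolding in_S_set_iff by blast
  define bs where "bs = map (\<lambda>j. of_nat (b j) :: zhat) [0..<n]"
  have "of_nat e dvd (\<Prod>b\<leftarrow>bs @ replicate e 0. of_nat r - b)" for r :: nat
  proof -
    have "(\<Prod>b\<leftarrow>bs @ replicate e 0. of_nat r - b)
        = (\<Prod>j<n. of_nat r - of_nat (b j)) * (of_nat r :: zhat) ^ e"
      using prod.distinct_set_conv_list [of "[0..<n]" "\<lambda>j. of_nat r - of_nat (b j) :: zhat"]
      by (simp add: bs_def prod_list_replicate o_def lessThan_atLeast0)
    also have "\<dots> = of_int (int r ^ e * (\<Prod>j<n. int r - int (b j)))"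
      by (simp add: mult.commute)
    also have "of_nat e dvd \<dots>"
      using b e by (subst of_nat_dvd_of_int_zhat) auto
    finally show ?thesis .
  qed
  then have "of_nat e dvd Phi_shifts (bs @ replicate e 0) H $ 0"
    by (rule dvd_Phi_shifts_nth_0)
  also have "\<dots> = Phi_shifts bs F $ 0"
    by (simp add: Phi_shifts_append_replicate H)
  also have "\<dots> = (-1) ^ n * of_nat (fact n) * d"
    using assms(2) Phi_shifts_leading [of n F bs] by (simp add: cong_monom_iff bs_def)
  finally have "of_nat e dvd (-1) ^ n * (of_nat (fact n) * d)"
    by (simp add: mult.assoc)
  then have "of_nat e dvd of_nat (fact n) * d"
    by (cases "even n") simp_all
  then obtain x where "of_nat (fact n) * d = of_nat (fact n) * (of_nat (d_seq n) * x)"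
    by (auto simp: e_def algebra_simps elim!: dvdE)
  then have "d = of_nat (d_seq n) * x"
    by (rule zhat_cancel_of_nat [rotated]) simp
  then show ?thesis by simp
qed


section \<open>Lagrange interpolation over commutative rings\<close>

text \<open>With zero divisors a polynomial may have more roots than its degree. The root bound
  survives when differences of roots are regular: a linear factor is split off, and regularity
  passes the other roots to the quotient.\<close>

lemma poly_eq_0_if_roots:
  fixes p :: "'a :: comm_ring_1 poly"
  assumes "finite I" and "\<And>i. i \<in> I \<Longrightarrow> poly p (a i) = 0" and "degree p < card I"
    and "\<And>i j x. i \<in> I \<Longrightarrow> j \<in> I \<Longrightarrow> i \<noteq> j \<Longrightarrow> (a i - a j) * x = 0 \<Longrightarrow> x = 0"
  shows "p = 0"
  using assms
proof (induction I arbitrary: p rule: finite_induct)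
  case (insert i I)
  define s where "s = synthetic_div p (a i)"
  have root: "poly p (a i) = 0"
    using insert.prems by simp
  have p: "p = [:- a i, 1:] * s"
    using synthetic_div_correct' [of "a i" p] root by (simp add: s_def)
  show ?case
  proof (cases "degree p = 0")
    case True
    then show ?thesis
      using root by (elim degree_eq_zeroE) simp
  next
    case False
    have "s = 0"
    proof (rule insert.IH)
      show "degree s < card I"
        using insert False by (simp add: s_def degree_synthetic_div)
      fix j assume j: "j \<in> I"
      have "(a j - a i) * poly s (a j) = poly p (a j)"
        by (subst p) (simp add: algebra_simps)
      also have "\<dots> = 0"
        using insert.prems j by simp
      finally show "poly s (a j) = 0"
        using insert.prems(3) [of j i] insert.hyps(2) j by auto
    qed (use insert.prems(3) in auto)
    then show ?thesis by (simp add: p)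
  qed
qed simp

lemma prod_linear_poly:
  fixes a :: "'b \<Rightarrow> 'a :: comm_ring_1"
  assumes "finite I"
  shows "degree (\<Prod>i\<in>I. [:- a i, 1:]) \<le> card I \<and> Polynomial.coeff (\<Prod>i\<in>I. [:- a i, 1:]) (card I) = 1"
  using assms
proof (induction I rule: finite_induct)
  case (insert i I)
  define P where "P = (\<Prod>i\<in>I. [:- a i, 1:])"
  have P: "degree P \<le> card I" "Polynomial.coeff P (card I) = 1" "Polynomial.coeff P (Suc (card I)) = 0"
    using insert by (auto simp: P_def coeff_eq_0)
  have "degree ([:- a i, 1:] * P) \<le> Suc (card I)"
    using degree_mult_le [of "[:- a i, 1:]" P] P(1) by (simp split: if_splits)
  then show ?case
    using insert P by (simp add: P_def)
qed simp

text \<open>Lagrange interpolation cleared of denominators: e q and the sum of c_j q(a_j) P_j agree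
  at all nodes, hence coincide, and the top coefficients are compared. Node differences are regular
  because they divide the regular element e.\<close>

lemma lagrange_leading_coeff:
  fixes a c :: "'b \<Rightarrow> 'a :: comm_ring_1"
  assumes I: "finite I" and c: "\<And>j. j \<in> I \<Longrightarrow> c j * (\<Prod>i\<in>I - {j}. a j - a i) = e"
    and e: "\<And>x. e * x = 0 \<Longrightarrow> x = 0" and q: "degree q < card I"
  shows "(\<Sum>j\<in>I. c j * poly q (a j)) = e * Polynomial.coeff q (card I - 1)"
proof -
  define P where "P = (\<lambda>j. \<Prod>i\<in>I - {j}. [:- a i, 1:])"
  define Q where "Q = (\<Sum>j\<in>I. Polynomial.smult (c j * poly q (a j)) (P j)) - Polynomial.smult e q"
  have P: "degree (P j) \<le> card I - 1" "Polynomial.coeff (P j) (card I - 1) = 1" if "j \<in> I" for j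
    using prod_linear_poly [of "I - {j}" a] I that by (simp_all add: P_def)
  have P_same: "c j * poly (P j) (a j) = e" if "j \<in> I" for j
    using c [OF that] by (simp add: P_def poly_prod)
  have P_other: "poly (P j) (a k) = 0" if "k \<in> I" "j \<noteq> k" for j k
    unfolding P_def poly_prod using I that by (intro prod_zero) auto
  have "Q = 0"
  proof (rule poly_eq_0_if_roots [OF I])
    fix k assume k: "k \<in> I"
    have "(\<Sum>j\<in>I. c j * poly q (a j) * poly (P j) (a k))
        = (\<Sum>j\<in>I. if j = k then c k * poly q (a k) * poly (P k) (a k) else 0)"
      using P_other [OF k] by (intro sum.cong) auto
    also have "\<dots> = c k * poly (P k) (a k) * poly q (a k)"
      using I k by simp
    also have "\<dots> = e * poly q (a k)"
      by (simp only: P_same [OF k])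
    finally show "poly Q (a k) = 0"
      by (simp add: Q_def poly_sum)
  next
    have "degree (\<Sum>j\<in>I. Polynomial.smult (c j * poly q (a j)) (P j)) \<le> card I - 1"
      using P(1) by (intro degree_sum_le I) (meson degree_smult_le le_trans)
    moreover have "degree (Polynomial.smult e q) \<le> card I - 1"
      using q degree_smult_le [of e q] by linarith
    ultimately have "degree Q \<le> card I - 1"
      unfolding Q_def by (rule degree_diff_le)
    then show "degree Q < card I"
      using q by linarith
  next
    fix i j x assume ij: "i \<in> I" "j \<in> I" "i \<noteq> j" and x: "(a i - a j) * x = 0"
    have "(\<Prod>k\<in>I - {i}. a i - a k) = (a i - a j) * (\<Prod>k\<in>I - {i} - {j}. a i - a k)"
      using I ij by (intro prod.remove) auto
    then have "e * x = c i * (\<Prod>k\<in>I - {i} - {j}. a i - a k) * ((a i - a j) * x)"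
      using c [OF ij(1)] by (simp add: mult_ac)
    then show "x = 0"
      using x e by simp
  qed
  then have "Polynomial.coeff Q (card I - 1) = 0"
    by simp
  then show ?thesis
    using P(2) by (simp add: Q_def coeff_sum)
qed


section \<open>Existence of $G_n$\<close>

text \<open>The idempotent glues two choices: \<alpha>_j is b_j at primes up to n + 2 and j + 1 at
  larger primes. The former is a unit there because b_j is prime to N, the latter because j + 1 <= n
  + 1. At the larger primes n!, hence every product of node differences, is a unit; at the others
  the extra cofactor m is.\<close>

lemma interpolation_nodes:
  fixes n :: nat
  shows "\<exists>\<alpha> c :: nat \<Rightarrow> zhat. (\<forall>j\<le>n. \<alpha> j dvd 1) \<and>
    (\<forall>j\<le>n. c j * (\<Prod>i\<in>{..n} - {j}. \<alpha> j - \<alpha> i) = of_nat (fact n * d_seq n))"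
proof -
  define e where "e = fact n * d_seq n"
  define N :: nat where "N = fact (n + 2)"
  obtain b :: "nat \<Rightarrow> nat" where cop: "\<And>j. coprime (b j) N"
    and diffs: "\<And>j. j \<le> n \<Longrightarrow>
      \<exists>m>0. coprime m N \<and> (\<Prod>i\<in>{..n} - {j}. int (b j) - int (b i)) dvd int e * int m"
    by (rule simultaneous_p_ordering [of n], rule that) (simp_all only: e_def N_def)
  have "N \<ge> n + 2"
    unfolding N_def by (rule fact_ge_self)
  then have b0: "b j > 0" for j
    using cop [of j] by (cases "b j = 0") simp_all
  have prime_dvd_N: "p dvd N" if "prime p" "p \<le> n + 2" for p
    unfolding N_def using that prime_dvd_fact_iff by blast
  obtain \<epsilon> :: zhat where idem: "\<epsilon> * \<epsilon> = \<epsilon>"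
    and smooth: "\<And>k. k > 0 \<Longrightarrow> (\<And>p. prime p \<Longrightarrow> p dvd k \<Longrightarrow> p dvd N) \<Longrightarrow> of_nat k dvd \<epsilon>"
    and coprime: "\<And>k. k > 0 \<Longrightarrow> coprime k N \<Longrightarrow> of_nat k dvd 1 - \<epsilon>"
    by (rule zhat_idempotentE [of N]) blast
  have idem': "(1 - \<epsilon>) * (1 - \<epsilon>) = 1 - \<epsilon>"
    by (simp add: algebra_simps idem)
  have mult: "(\<epsilon> * x + (1 - \<epsilon>) * y) * (\<epsilon> * z + (1 - \<epsilon>) * w) = \<epsilon> * (x * z) + (1 - \<epsilon>) * (y * w)"
    for x y z w
    using prod_idempotent_split [OF idem, of "\<lambda>i. if i then x else z" "\<lambda>i. if i then y else w" "UNIV :: bool set"]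
    by (simp add: UNIV_bool mult.commute)
  define \<alpha> where "\<alpha> = (\<lambda>j. \<epsilon> * of_nat (Suc j) + (1 - \<epsilon>) * of_nat (b j))"
  have unit: "\<alpha> j dvd 1" if j: "j \<le> n" for j
  proof -
    have "of_nat (Suc j) dvd \<epsilon>"
    proof (rule smooth)
      fix p :: nat assume p: "prime p" "p dvd Suc j"
      then have "p \<le> Suc j"
        by (intro dvd_imp_le) auto
      then show "p dvd N"
        using p(1) j by (intro prime_dvd_N) auto
    qed simp
    then obtain s where s: "\<epsilon> = of_nat (Suc j) * s" by (elim dvdE)
    obtain t where t: "1 - \<epsilon> = of_nat (b j) * t"
      using coprime [OF b0 cop, of j] by (elim dvdE)
    \<comment> \<open>In the two factors of the ring, s and t invert j + 1 and b_j.\<close>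
    have "\<alpha> j * (\<epsilon> * s + (1 - \<epsilon>) * t) = \<epsilon> * (of_nat (Suc j) * s) + (1 - \<epsilon>) * (of_nat (b j) * t)"
      unfolding \<alpha>_def by (rule mult)
    also have "\<dots> = 1"
      unfolding s [symmetric] t [symmetric] idem idem' by simp
    finally show ?thesis
      by (metis dvd_triv_left)
  qed
  have "\<exists>c. c * (\<Prod>i\<in>{..n} - {j}. \<alpha> j - \<alpha> i) = of_nat e" if j: "j \<le> n" for j
  proof -
    define D where "D = (\<Prod>i\<in>{..n} - {j}. int j - int i)"
    define E where "E = (\<Prod>i\<in>{..n} - {j}. int (b j) - int (b i))"
    have "of_int D dvd (of_int (fact n) :: zhat)"
    proof -
      have "D dvd fact n"
        unfolding D_def using j by (rule prod_differences_dvd_fact)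
      then obtain x where "fact n = D * x" by (elim dvdE)
      then show ?thesis by simp
    qed
    also have "(of_int (fact n) :: zhat) = of_nat (fact n)"
      by (metis of_int_of_nat_eq of_nat_fact)
    also have "of_nat (fact n) dvd \<epsilon>"
    proof (rule smooth)
      fix p :: nat assume p: "prime p" "p dvd fact n"
      then have "p \<le> n"
        using prime_dvd_fact_iff by blast
      then show "p dvd N"
        using p(1) by (intro prime_dvd_N) auto
    qed simp
    finally obtain s where s: "\<epsilon> = of_int D * s" by (elim dvdE)
    obtain m where m: "m > 0" "coprime m N" "E dvd int e * int m"
      unfolding E_def using diffs [OF j] by blast
    obtain h where h: "int e * int m = E * h"
      using m(3) by (elim dvdE)
    obtain t where t: "1 - \<epsilon> = of_nat m * t"
      using coprime [OF m(1,2)] by (elim dvdE)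
    have h': "of_int E * of_int h = (of_nat e * of_nat m :: zhat)"
      by (metis h of_int_mult of_int_of_nat_eq)
    have "\<alpha> j - \<alpha> i = \<epsilon> * of_int (int j - int i) + (1 - \<epsilon>) * of_int (int (b j) - int (b i))" for i
      by (simp add: \<alpha>_def algebra_simps)
    then have "(\<Prod>i\<in>{..n} - {j}. \<alpha> j - \<alpha> i) = \<epsilon> * of_int D + (1 - \<epsilon>) * of_int E"
      by (simp only: prod_idempotent_split [OF idem] D_def E_def of_int_prod)
    \<comment> \<open>The witness c_j is e / D in one factor. In the other it is h / m, where E h =
      e m.\<close>
    then have "(\<Prod>i\<in>{..n} - {j}. \<alpha> j - \<alpha> i) * (\<epsilon> * (of_nat e * s) + (1 - \<epsilon>) * (of_int h * t))
        = \<epsilon> * (of_int D * (of_nat e * s)) + (1 - \<epsilon>) * (of_int E * (of_int h * t))"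
      by (simp only: mult)
    also have "of_int D * (of_nat e * s) = of_nat e * \<epsilon>"
      by (simp add: s mult_ac)
    also have "of_int E * (of_int h * t) = of_nat e * (1 - \<epsilon>)"
      by (simp add: t mult.assoc [symmetric] h')
    also have "\<epsilon> * (of_nat e * \<epsilon>) + (1 - \<epsilon>) * (of_nat e * (1 - \<epsilon>))
        = of_nat e * (\<epsilon> * \<epsilon> + (1 - \<epsilon>) * (1 - \<epsilon>))"
      by (simp only: distrib_left mult_ac)
    also have "\<dots> = of_nat e"
      by (simp only: idem idem') simp
    finally show ?thesis
      by (metis mult.commute)
  qed
  then obtain c where c: "\<And>j. j \<le> n \<Longrightarrow> c j * (\<Prod>i\<in>{..n} - {j}. \<alpha> j - \<alpha> i) = of_nat e"
    by metis
  show ?thesis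
    unfolding e_def [symmetric] using unit c by blast
qed

lemma is_G_exists: "\<exists>G. is_G n G"
proof -
  define e where "e = fact n * d_seq n"
  have e0: "e > 0"
    using d_seq_pos [of n] by (simp add: e_def)
  obtain \<alpha> c :: "nat \<Rightarrow> zhat" where unit: "\<And>j. j \<le> n \<Longrightarrow> \<alpha> j dvd 1"
    and c: "\<And>j. j \<le> n \<Longrightarrow> c j * (\<Prod>i\<in>{..n} - {j}. \<alpha> j - \<alpha> i) = of_nat e"
    using interpolation_nodes [of n] unfolding e_def by metis
  \<comment> \<open>The sign cancels that of x^n in the series A; nodes are numbered from 0,
    summands from 1.\<close>
  define G where "G = (\<Sum>i=1..n+1. fps_const ((-1) ^ n * c (i - 1)) * A_series (\<alpha> (i - 1)))"
  have nth: "of_nat (fact i) * G $ i = (if i = n then of_nat e else 0)" if i: "i \<le> n" for i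
  proof -
    \<comment> \<open>The falling factorial, whose value at a is i! times the binomial coefficient.
      Being monic of degree i, it has coefficient 0 or 1 at degree n, according to whether i < n or
      i = n.\<close>
    define q :: "zhat poly" where "q = (\<Prod>l<i. [:- of_nat l, 1:])"
    have q: "degree q \<le> i" "Polynomial.coeff q i = 1"
      using prod_linear_poly [of "{..<i}" "\<lambda>l. of_nat l :: zhat"] by (simp_all add: q_def)
    have "G = (\<Sum>j\<le>n. fps_const ((-1) ^ n * c j) * A_series (\<alpha> j))"
      unfolding G_def
      by (rule sum.reindex_bij_witness [of _ Suc "\<lambda>i. i - 1"]) auto
    then have "of_nat (fact i) * G $ i
        = (-1) ^ (n + i) * (\<Sum>j\<le>n. c j * (of_nat (fact i) * zhat_choose (\<alpha> j) i))"
      by (simp add: fps_sum_nth A_series_def sum_distrib_left power_add mult_ac)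
    also have "\<dots> = (-1) ^ (n + i) * (\<Sum>j\<le>n. c j * poly q (\<alpha> j))"
      by (simp only: zhat_choose_mult_fact) (simp add: q_def poly_prod)
    also have "(\<Sum>j\<le>n. c j * poly q (\<alpha> j)) = of_nat e * Polynomial.coeff q (card {..n} - 1)"
      using c q(1) i zhat_torsion_free [OF e0] by (intro lagrange_leading_coeff) auto
    also have "(-1) ^ (n + i) * \<dots> = (if i = n then of_nat e else 0)"
      using q i by (auto simp: coeff_eq_0 simp flip: mult_2)
    finally show ?thesis .
  qed
  have "G $ i = 0" if "i < n" for i
    using nth [of i] that zhat_torsion_free [of "fact i" "G $ i"] by simp
  moreover have "G $ n = of_nat (d_seq n)"
  proof (rule zhat_cancel_of_nat)
    show "of_nat (fact n) * G $ n = of_nat (fact n) * of_nat (d_seq n)"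
      using nth [of n] by (simp add: e_def)
  qed simp
  ultimately have G: "cong_monom G (of_nat (d_seq n)) n"
    by (simp add: cong_monom_iff)
  have "is_G n G"
    unfolding is_G_def
  proof (intro conjI exI)
    show "\<forall>i\<in>{1..n+1}. \<alpha> (i - 1) dvd 1"
      using unit by auto
  qed (rule G_def, rule G)
  then show ?thesis ..
qed


section \<open>The set $S$\<close>

lemma S_set_expansion:
  assumes G: "\<And>k. is_G k (G k)" and F: "F \<in> S_set"
  obtains c where "(\<lambda>k. fps_const (c k) * G k) sums F"
proof -
  \<comment> \<open>The state holds the current remainder and the position to be cleared next. The
    choice of x is justified afterwards, when all remainders are shown to lie in S.\<close>
  define step where "step = (\<lambda>(H :: zhat fps, k).
    (H - fps_const (SOME x. H $ k = of_nat (d_seq k) * x) * G k, Suc k))"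
  define R where "R = (\<lambda>m. fst ((step ^^ m) (F, 0)))"
  define c where "c = (\<lambda>k. SOME x. R k $ k = of_nat (d_seq k) * x)"
  have snd: "snd ((step ^^ m) (F, 0)) = m" for m
    by (induction m) (simp_all add: step_def split_beta)
  have R0: "R 0 = F"
    by (simp add: R_def)
  have R_Suc: "R (Suc m) = R m - fps_const (c m) * G m" for m
  proof -
    have "R (Suc m) = fst (step ((step ^^ m) (F, 0)))"
      by (simp add: R_def)
    also have "(step ^^ m) (F, 0) = (R m, m)"
      by (simp add: R_def snd prod_eq_iff)
    finally show ?thesis
      by (simp add: step_def c_def)
  qed
  have R: "R m \<in> S_set \<and> (\<forall>i<m. R m $ i = 0)" for m
  proof (induction m)
    case (Suc m)
    then have "of_nat (d_seq m) dvd R m $ m"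
      by (intro d_seq_dvd_leading_coeff) (auto simp: cong_monom_iff)
    then have "\<exists>x. R m $ m = of_nat (d_seq m) * x"
      by (simp add: dvd_def)
    then have "R m $ m = of_nat (d_seq m) * c m"
      unfolding c_def by (rule someI_ex)
    then have "R (Suc m) $ i = 0" if "i < Suc m" for i
      using Suc that is_G_nth_less [OF G, of i m] is_G_nth_self [OF G, of m]
      by (cases "i = m") (auto simp: R_Suc mult.commute)
    moreover have "R (Suc m) \<in> S_set"
      unfolding R_Suc using Suc by (intro S_set_diff S_set_cmult is_G_in_S_set [OF G]) auto
    ultimately show ?case by blast
  qed (simp add: R0 F)
  have sum: "(\<Sum>k<m. fps_const (c k) * G k) = F - R m" for m
    by (induction m) (simp_all add: R0 R_Suc)
  have "(\<lambda>k. fps_const (c k) * G k) sums F"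
    unfolding sums_def sum
  proof (rule tendsto_fpsI)
    fix i
    \<comment> \<open>The remainder \<open>R m\<close> vanishes below degree m, so coefficient i is
      settled from m = i + 1 on.\<close>
    show "\<forall>\<^sub>F m in sequentially. (F - R m) $ i = F $ i"
      unfolding eventually_sequentially using R by (intro exI [of _ "Suc i"]) auto
  qed
  then show thesis by (rule that)
qed

theorem theorem6p25:
  fixes n :: nat
  shows "(\<exists>G. is_G n G) \<and>
    (\<forall>d. (\<exists>F\<in>S_set. cong_monom F d n) \<longleftrightarrow> of_nat (d_seq n) dvd d) \<and>
    (\<forall>G. (\<forall>k. is_G k (G k)) \<longrightarrow>
       S_set = {F. \<exists>c. (\<lambda>k. fps_const (c k) * G k) sums F})"
proof (intro conjI allI impI)
  show "\<exists>G. is_G n G"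
    by (rule is_G_exists)
next
  fix d
  show "(\<exists>F\<in>S_set. cong_monom F d n) \<longleftrightarrow> of_nat (d_seq n) dvd d"
  proof
    assume "\<exists>F\<in>S_set. cong_monom F d n"
    then show "of_nat (d_seq n) dvd d"
      using d_seq_dvd_leading_coeff by blast
  next
    assume "of_nat (d_seq n) dvd d"
    then obtain x where d: "d = of_nat (d_seq n) * x" by (elim dvdE)
    obtain G where G: "is_G n G"
      using is_G_exists by blast
    have "fps_const x * G \<in> S_set"
      using G by (intro S_set_cmult is_G_in_S_set)
    moreover have "cong_monom (fps_const x * G) d n"
      using G by (simp add: cong_monom_iff d is_G_nth_less is_G_nth_self mult.commute)
    ultimately show "\<exists>F\<in>S_set. cong_monom F d n" by blast
  qed
next
  fix G assume G: "\<forall>k. is_G k (G k)"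
  show "S_set = {F. \<exists>c. (\<lambda>k. fps_const (c k) * G k) sums F}"
  proof (intro equalityI subsetI CollectI)
    fix F assume "F \<in> S_set"
    then show "\<exists>c. (\<lambda>k. fps_const (c k) * G k) sums F"
      using G by (elim S_set_expansion [rotated]) auto
  next
    fix F assume "F \<in> {F. \<exists>c. (\<lambda>k. fps_const (c k) * G k) sums F}"
    then show "F \<in> S_set"
      using G G_combination_in_S_set by blast
  qed
qed

end
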